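(* Let $d\ge 1$. The restriction of the map $\Phi\colon\mathcal{M}\to\mathcal{F}$, $(D,R)\mapsto\det(tI_d+xD+yR)$, to $\Phi^{-1}(\mathcal{H}^\circ)$ is smooth; that is, $\Phi$, as a morphism of complex affine spaces, is smooth at every point $(D,R)\in\mathcal{M}$ with $\Phi(D,R)\in\mathcal{H}^\circ$.
   Context: Fix $d\ge 1$. Let $\mathcal{F}$ be the set of polynomials $p\in\mathbb{C}[t,x,y]$ that are homogeneous of total degree $d$ and satisfy $p(1,0,0)=1$ (a complex affine space), and let $\mathcal{F}_{\mathbb{R}}=\mathcal{F}\cap\mathbb{R}[t,x,y]$. A polynomial $p\in\mathcal{F}_{\mathbb{R}}$ is hyperbolic if for every $u\in\mathbb{R}^2$ all roots of the univariate polynomial $p(t,u)\in\mathbb{R}[t]$ are real. $\mathcal{H}^\circ$ is the set of hyperbolic $p\in\mathcal{F}_{\mathbb{R}}$ such that the complex projective plane curve $\mathcal{V}_{\mathbb{C}}(p)\subset\mathbb{P}^2(\mathbb{C})$ defined by $p$ is smooth. $\mathcal{M}$ is the complex vector space of pairs $(D,R)$ of complex symmetric $d\times d$ matrices with $D$ diagonal; $I_d$ is the identity matrix. One has $\dim_{\mathbb{C}}\mathcal{M}=\dim_{\mathbb{C}}\mathcal{F}=\frac{d(d+3)}{2}$. Smoothness of $\Phi$ at a point is in the sense of algebraic geometry (Hartshorne III.10), i.e. the differential $d\Phi$ at that point is surjective (equivalently here, bijective). *)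

theory Defs
  imports "HOL-Analysis.Analysis" "HOL-Computational_Algebra.Polynomial"
begin

text \<open>
  The ring \<open>\<complex>[t,x,y]\<close> is represented as \<open>\<complex>[y][x][t]\<close>: the outermost polynomial variable
  is \<open>t\<close>, the innermost one is \<open>y\<close>.
\<close>

type_synonym poly3 = "complex poly poly poly"

definition var_t :: poly3 where "var_t = [:0, 1:]"
definition var_x :: poly3 where "var_x = [:[:0, 1:]:]"
definition var_y :: poly3 where "var_y = [:[:[:0, 1:]:]:]"

definition const3 :: "complex \<Rightarrow> poly3" where
  "const3 c = [:[:[:c:]:]:]"

text \<open>The coefficient of \<open>t^i x^j y^k\<close>.\<close>

definition coeff3 :: "poly3 \<Rightarrow> nat \<Rightarrow> nat \<Rightarrow> nat \<Rightarrow> complex" where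
  "coeff3 p i j k = coeff (coeff (coeff p i) j) k"

definition eval3 :: "poly3 \<Rightarrow> complex \<Rightarrow> complex \<Rightarrow> complex \<Rightarrow> complex" where
  "eval3 p t x y = poly (poly (poly p [:[:t:]:]) [:x:]) y"

definition pderiv_t :: "poly3 \<Rightarrow> poly3" where "pderiv_t p = pderiv p"
definition pderiv_x :: "poly3 \<Rightarrow> poly3" where "pderiv_x p = map_poly pderiv p"
definition pderiv_y :: "poly3 \<Rightarrow> poly3" where "pderiv_y p = map_poly (map_poly pderiv) p"

text \<open>As usual, the zero polynomial counts as homogeneous of every degree.\<close>

definition homogeneous3 :: "nat \<Rightarrow> poly3 \<Rightarrow> bool" where
  "homogeneous3 d p \<longleftrightarrow> (\<forall>i j k. coeff3 p i j k \<noteq> 0 \<longrightarrow> i + j + k = d)"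

definition F_space :: "nat \<Rightarrow> poly3 set" where
  "F_space d = {p. homogeneous3 d p \<and> eval3 p 1 0 0 = 1}"

definition F_real :: "nat \<Rightarrow> poly3 set" where
  "F_real d = {p \<in> F_space d. \<forall>i j k. coeff3 p i j k \<in> \<real>}"

definition hyperbolic :: "poly3 \<Rightarrow> bool" where
  "hyperbolic p \<longleftrightarrow>
     (\<forall>(u1::real) (u2::real) (t::complex).
        eval3 p t (of_real u1) (of_real u2) = 0 \<longrightarrow> t \<in> \<real>)"

text \<open>
  Smoothness of the plane curve (as a scheme) defined by the homogeneous polynomial \<open>p\<close>: at no
  point of the curve, given by homogeneous coordinates \<open>(t,x,y) \<noteq> 0\<close>, do all partial derivatives
  of \<open>p\<close> vanish. In particular \<open>p\<close> with a repeated factor does not define a smooth curve.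
\<close>

definition smooth_curve :: "poly3 \<Rightarrow> bool" where
  "smooth_curve p \<longleftrightarrow>
     (\<forall>t x y. (t, x, y) \<noteq> (0, 0, 0) \<and> eval3 p t x y = 0 \<longrightarrow>
        \<not> (eval3 (pderiv_t p) t x y = 0 \<and>
           eval3 (pderiv_x p) t x y = 0 \<and>
           eval3 (pderiv_y p) t x y = 0))"

definition H_smooth :: "nat \<Rightarrow> poly3 set" where
  "H_smooth d = {p \<in> F_real d. hyperbolic p \<and> smooth_curve p}"

definition M_space :: "((complex^'n^'n) \<times> (complex^'n^'n)) set" where
  "M_space = {(D, R). (\<forall>i j. i \<noteq> j \<longrightarrow> D $ i $ j = 0) \<and> transpose R = R}"

definition Phi :: "(complex^'n^'n) \<times> (complex^'n^'n) \<Rightarrow> poly3" where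
  "Phi = (\<lambda>(D, R).
     det (mat var_t + (\<chi> i j. var_x * const3 (D $ i $ j) + var_y * const3 (R $ i $ j))))"

text \<open>
  \<open>L\<close> is the differential at \<open>v\<close> of the map \<open>f\<close> from the vector space \<open>M\<close> to polynomials, the
  latter being equipped with their coefficients as coordinates. Only the values of \<open>L\<close> on \<open>M\<close>
  are meaningful, and these are uniquely determined if \<open>M\<close> is a linear subspace containing \<open>v\<close>.
  For polynomial maps on a complex space, the real Frechet derivative is automatically
  complex linear on \<open>M\<close> and is the algebraic differential.
\<close>

definition has_differential ::
  "('v::real_normed_vector \<Rightarrow> poly3) \<Rightarrow> ('v \<Rightarrow> poly3) \<Rightarrow> 'v \<Rightarrow> 'v set \<Rightarrow> bool" where
  "has_differential f L v M \<longleftrightarrow>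
     (\<forall>i j k. ((\<lambda>w. coeff3 (f w) i j k) has_derivative (\<lambda>w. coeff3 (L w) i j k)) (at v within M))"

text \<open>
  Smoothness at \<open>v\<close> of a morphism \<open>f\<close> from a vector space \<open>M\<close> to an affine space \<open>F\<close> of
  polynomials: the differential is onto the tangent space of \<open>F\<close>, which is its space of
  translations.
\<close>

definition smooth_morphism_at ::
  "('v::real_normed_vector \<Rightarrow> poly3) \<Rightarrow> 'v set \<Rightarrow> poly3 set \<Rightarrow> 'v \<Rightarrow> bool" where
  "smooth_morphism_at f M F v \<longleftrightarrow>
     (\<exists>L. has_differential f L v M \<and> L ` M = {p - q | p q. p \<in> F \<and> q \<in> F})"

end

(*
  Both sides have dimension d(d+3)/2, so it suffices that the differential is injective on M.
  Let T(x,y) = xD + yR and N(x,y) = xD' + yR', and suppose that (D',R') is in the kernel. Smoothness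
  of the curve makes T(x,y) nonderogatory for all (x,y) /= 0, so that its commutant consists of
  polynomials in T(x,y), which are symmetric. That the differential kills (D',R') means that
  N(x,y) is orthogonal, for the trace form, to all powers of T(x,y); hence N(x,y) = [T(x,y), Y]
  for a unique antisymmetric Y = Y(x,y). It is homogeneous of degree 0, so Y(1,z) is a bounded
  entire function of z, hence a constant X. Then D' = [D,X] has zero diagonal, so D' = 0, so X is
  an antisymmetric polynomial in D, so X = 0 and R' = 0.
*)
theory Submission
  imports Defs "HOL-Complex_Analysis.Cauchy_Integral_Formula"
    "HOL-Computational_Algebra.Fundamental_Theorem_Algebra"
begin

text \<open>The equation [T(x,y), Y] = N(x,y) with Y antisymmetric is overdetermined: d(d-1)/2
  unknowns, d(d+1)/2 equations. So Cramer's rule does not directly give Y(1,z) as a function of z,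
  and one estimate takes its place. As [T(x,y), -] is injective on antisymmetric matrices for all
  (x,y) /= 0, compactness gives c |(x,y)| |Y| <= |[T(x,y), Y]| with c > 0. Applied to Y itself it
  gives boundedness; applied to difference quotients of Y, which solve an equation of the same kind,
  it gives complex differentiability. Uniformity for large z reflects that T is nonderogatory at
  (0,1) as well. Existence of Y is a duality statement. The trace form on complex matrices is not
  definite, so the projection is taken for the inner product Re tr(conj(A)^T B), and conjugation
  translates between the two. The traces come from Jacobi's formula: the derivative of det(I + sT)
  along N is det(I + sT) tr((I + sT)^(-1) N), which up to signs and the determinant is the
  generating function of the tr(T^k N).\<close>

section \<open>Linear systems over a field\<close>

lemma homogeneous_system_nontrivial_solution:
  fixes A :: "'i \<Rightarrow> 'j \<Rightarrow> 'a::field"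
  assumes "finite J" "finite I" "card J < card I"
  shows "\<exists>c. (\<exists>i\<in>I. c i \<noteq> 0) \<and> (\<forall>j\<in>J. (\<Sum>i\<in>I. c i * A i j) = 0)"
  using assms
proof (induction J arbitrary: I A rule: finite_induct)
  case empty
  then obtain i where "i \<in> I" by fastforce
  then show ?case by (intro exI[of _ "\<lambda>_. 1"]) auto
next
  case (insert j J)
  show ?case
  proof (cases "\<forall>i\<in>I. A i j = 0")
    case True
    obtain c where "\<exists>i\<in>I. c i \<noteq> 0" "\<forall>j\<in>J. (\<Sum>i\<in>I. c i * A i j) = 0"
      using insert.IH[of I A] insert.prems insert.hyps by auto
    with True show ?thesis by (intro exI[of _ c]) auto
  next
    case False
    \<comment> \<open>Gaussian elimination with pivot \<open>A k j\<close>: unknown \<open>k\<close>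
      is eliminated from the remaining equations and recovered afterwards from equation
      \<open>j\<close>.\<close>
    then obtain k where k: "k \<in> I" "A k j \<noteq> 0" by blast
    define I' where "I' = I - {k}"
    have I': "finite I'" "card J < card I'"
      using insert.prems insert.hyps k by (auto simp: I'_def)
    obtain c where c: "\<exists>i\<in>I'. c i \<noteq> 0"
        "\<forall>l\<in>J. (\<Sum>i\<in>I'. c i * (A i l - A i j / A k j * A k l)) = 0"
      using insert.IH[OF I', of "\<lambda>i l. A i l - A i j / A k j * A k l"] by auto
    define s where "s = (\<Sum>i\<in>I'. c i * A i j)"
    define c' where "c' = c(k := - s / A k j)"
    have split: "(\<Sum>i\<in>I. c' i * A i l) = - s / A k j * A k l + (\<Sum>i\<in>I'. c i * A i l)" for l
    proof -
      have "(\<Sum>i\<in>I. c' i * A i l) = c' k * A k l + (\<Sum>i\<in>I'. c' i * A i l)"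
        unfolding I'_def using insert.prems k by (intro sum.remove) auto
      also have "(\<Sum>i\<in>I'. c' i * A i l) = (\<Sum>i\<in>I'. c i * A i l)"
        by (intro sum.cong) (auto simp: c'_def I'_def)
      finally show ?thesis by (simp add: c'_def)
    qed
    have "(\<Sum>i\<in>I. c' i * A i l) = 0" if l: "l \<in> insert j J" for l
    proof (cases "l = j")
      case True
      then show ?thesis using k by (simp add: split s_def[symmetric])
    next
      case False
      then have "(\<Sum>i\<in>I'. c i * (A i l - A i j / A k j * A k l)) = 0" using c l by auto
      then have "(\<Sum>i\<in>I'. c i * A i l) = s / A k j * A k l"
        by (simp add: right_diff_distrib sum_subtractf s_def sum_divide_distrib
            sum_distrib_right mult.assoc)
      then show ?thesis by (simp add: split)
    qed
    moreover have "\<exists>i\<in>I. c' i \<noteq> 0" using c(1) by (auto simp: c'_def I'_def)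
    ultimately show ?thesis by blast
  qed
qed

text \<open>The right-hand side is adjoined as one more unknown \<open>None\<close> with
  coefficients \<open>- b j\<close>. The homogeneous system then has a nontrivial solution;
  injectivity forces its \<open>None\<close> component to be nonzero, and dividing by it solves the
  original system.\<close>

lemma injective_square_system_solvable:
  fixes A :: "'i \<Rightarrow> 'j \<Rightarrow> 'a::field"
  assumes fin: "finite I" "finite J" and card: "card I = card J"
    and inj: "\<And>c. \<forall>j\<in>J. (\<Sum>i\<in>I. c i * A i j) = 0 \<Longrightarrow> \<forall>i\<in>I. c i = 0"
  shows "\<exists>c. \<forall>j\<in>J. (\<Sum>i\<in>I. c i * A i j) = b j"
proof -
  define I' where "I' = insert None (Some ` I)"
  define A' where "A' = (\<lambda>i j. case i of None \<Rightarrow> - b j | Some i \<Rightarrow> A i j)"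
  have "finite I'" "card J < card I'"
    using fin card by (auto simp: I'_def card_image)
  then obtain c where c: "\<exists>i\<in>I'. c i \<noteq> 0" "\<forall>j\<in>J. (\<Sum>i\<in>I'. c i * A' i j) = 0"
    using homogeneous_system_nontrivial_solution[OF fin(2), of I' A'] by blast
  have *: "(\<Sum>i\<in>I. c (Some i) * A i j) = c None * b j" if "j \<in> J" for j
  proof -
    have "(\<Sum>i\<in>I'. c i * A' i j) = - (c None * b j) + (\<Sum>i\<in>I. c (Some i) * A i j)"
      using fin by (simp add: I'_def A'_def sum.reindex)
    then show ?thesis using c that by simp
  qed
  have "c None \<noteq> 0"
  proof
    assume 0: "c None = 0"
    then have "\<forall>i\<in>I. c (Some i) = 0" using * by (intro inj) auto
    then show False using 0 c(1) by (auto simp: I'_def)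
  qed
  then show ?thesis using *
    by (intro exI[of _ "\<lambda>i. c (Some i) / c None"]) (simp add: sum_divide_distrib[symmetric])
qed

section \<open>Matrix algebra and polynomials in a matrix\<close>

lemma mat_mult_nth [simp]: "(mat c ** A) $ i $ j = c * A $ i $ j"
  and mult_mat_nth [simp]: "(A ** mat c) $ i $ j = A $ i $ j * c"
  for A :: "'a::semiring_1^'n^'n"
  by (simp_all add: matrix_matrix_mult_def mat_def if_distrib if_distribR cong: if_cong)

lemma mat_mult_commute: "mat c ** A = A ** mat c"
  for A :: "'a::comm_semiring_1^'n^'n"
  by (simp add: vec_eq_iff mult.commute)

lemma mat_mult_vec [simp]: "mat c *v v = c *s v"
  for v :: "'a::semiring_1^'n"
  by (simp add: vec_eq_iff matrix_vector_mult_def mat_def if_distrib if_distribR cong: if_cong)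

lemma matrix_sub_ldistrib: "A ** (B - C) = A ** B - A ** C"
  for A :: "'a::ring_1^'n^'m"
  by (vector matrix_matrix_mult_def sum_subtractf[symmetric] field_simps)

lemma matrix_sub_rdistrib: "(A - B) ** C = A ** C - B ** C"
  for A :: "'a::ring_1^'n^'m"
  by (vector matrix_matrix_mult_def sum_subtractf[symmetric] field_simps)

lemma matrix_add_rdistrib: "(A + B) ** C = A ** C + B ** C"
  for A :: "'a::semiring_1^'n^'m"
  by (vector matrix_matrix_mult_def sum.distrib[symmetric] field_simps)

lemma mat_add: "mat (a + b) = mat a + mat b"
  for a b :: "'a::semiring_1"
  by (simp add: vec_eq_iff mat_def)

definition poly_mat :: "'a::comm_ring_1^'n^'n \<Rightarrow> 'a poly \<Rightarrow> 'a^'n^'n" where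
  "poly_mat T p = fold_coeffs (\<lambda>a A. mat a + T ** A) p 0"

lemma poly_mat_0 [simp]: "poly_mat T 0 = 0"
  by (simp add: poly_mat_def)

lemma poly_mat_pCons [simp]: "poly_mat T (pCons a p) = mat a + T ** poly_mat T p"
proof (cases "a = 0 \<and> p = 0")
  case True
  then show ?thesis by (simp add: poly_mat_def vec_eq_iff mat_def matrix_matrix_mult_def)
next
  case False
  then show ?thesis by (cases "a = 0") (simp_all add: poly_mat_def)
qed

lemma poly_mat_add: "poly_mat T (p + q) = poly_mat T p + poly_mat T q"
proof (induction p q rule: poly_induct2)
  case (pCons a p b q)
  then show ?case by (simp add: matrix_add_ldistrib mat_add)
qed simp

lemma poly_mat_smult: "poly_mat T (smult c p) = mat c ** poly_mat T p"
proof (induction p)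
  case (pCons a p)
  have "mat (c * a) = mat c ** (mat a :: 'a^'b^'b)"
    unfolding vec_eq_iff mat_mult_nth by (simp add: mat_def)
  then show ?case using pCons
    by (simp add: matrix_add_ldistrib matrix_mul_assoc mat_mult_commute[of c T])
qed simp

lemma poly_mat_commute:
  assumes "T ** B = B ** T"
  shows "poly_mat T p ** B = B ** poly_mat T p"
proof (induction p)
  case (pCons a p)
  have "T ** poly_mat T p ** B = B ** (T ** poly_mat T p)"
    by (metis pCons(2) assms matrix_mul_assoc)
  then show ?case
    by (simp add: matrix_add_rdistrib matrix_add_ldistrib mat_mult_commute)
qed simp

lemma poly_mat_mult: "poly_mat T (p * q) = poly_mat T p ** poly_mat T q"
proof (induction p)
  case (pCons a p)
  then show ?case
    by (simp add: poly_mat_add poly_mat_smult matrix_add_rdistrib matrix_mul_assoc)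
qed simp

lemma transpose_add: "transpose (A + B) = transpose A + transpose B"
  and transpose_diff: "transpose (C - E) = transpose C - transpose E"
  by (simp_all add: vec_eq_iff transpose_def)

lemma transpose_poly_mat:
  assumes "transpose T = T"
  shows "transpose (poly_mat T p) = poly_mat T p"
proof (induction p)
  case (pCons a p)
  have "transpose (T ** poly_mat T p) = T ** poly_mat T p"
    using pCons assms poly_mat_commute[of T T p] by (simp add: matrix_transpose_mul)
  then show ?case by (simp add: transpose_add transpose_mat)
qed (simp add: transpose_def vec_eq_iff)

lemma poly_mat_sum: "poly_mat T (sum f A) = (\<Sum>a\<in>A. poly_mat T (f a))"
  by (induction A rule: infinite_finite_induct) (simp_all add: poly_mat_add)

text \<open>The n^2 + 1 powers of \<open>T\<close> up to exponent n^2 are dependent in a space of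
  dimension n^2. Any nonzero annihilator serves below, so the degree is not optimized.\<close>

lemma ex_annihilating_poly:
  fixes T :: "'a::field^'n^'n"
  shows "\<exists>p. p \<noteq> 0 \<and> poly_mat T p = 0"
proof -
  define m where "m = card (UNIV :: ('n \<times> 'n) set)"
  obtain c where c: "\<exists>k\<in>{..m}. c k \<noteq> 0"
      "\<And>i j. (\<Sum>k\<le>m. c k * poly_mat T (monom 1 k) $ i $ j) = 0"
    using homogeneous_system_nontrivial_solution
      [of "UNIV :: ('n \<times> 'n) set" "{..m}" "\<lambda>k (i, j). poly_mat T (monom 1 k) $ i $ j"]
    by (auto simp: m_def)
  define p where "p = (\<Sum>k\<le>m. smult (c k) (monom 1 k))"
  have "coeff p k = c k" if "k \<le> m" for k
    using that by (simp add: p_def coeff_sum if_distrib cong: if_cong)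
  then have "p \<noteq> 0" using c(1) by force
  moreover have "poly_mat T p = 0"
    using c(2) by (simp add: p_def poly_mat_sum poly_mat_smult vec_eq_iff)
  ultimately show ?thesis by blast
qed

section \<open>Nonderogatory matrices and their commutants\<close>

text \<open>All eigenspaces have dimension at most one; equivalently, the minimal polynomial is the
  characteristic polynomial.\<close>

definition nonderogatory :: "complex^'n^'n \<Rightarrow> bool" where
  "nonderogatory T \<longleftrightarrow>
     (\<forall>l v w. T *v v = l *s v \<longrightarrow> T *v w = l *s w \<longrightarrow> v \<noteq> 0 \<longrightarrow> (\<exists>c. w = c *s v))"

text \<open>By induction on the degree of \<open>s\<close>, \<open>B\<close> agrees on \<open>ker s(T)\<close> with a polynomial in \<open>T\<close>; then let
  \<open>s\<close> annihilate \<open>T\<close>.\<close>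

lemma nonderogatory_commutant:
  assumes nd: "nonderogatory T" and comm: "T ** B = B ** T"
  shows "\<exists>q. B = poly_mat T q"
proof -
  have step: "\<exists>q. \<forall>u. poly_mat T s *v u = 0 \<longrightarrow> B *v u = poly_mat T q *v u"
    if "s \<noteq> 0" for s
    using that
  proof (induction "degree s" arbitrary: s)
    case 0
    then obtain c where "s = [:c:]" "c \<noteq> 0" by (metis pCons_0_0 degree_eq_zeroE)
    then show ?case by (intro exI[of _ 0]) simp
  next
    case (Suc n)
    then have "\<not> constant (poly s)" by (simp add: constant_degree)
    then obtain l where "poly s l = 0" using fundamental_theorem_of_algebra by blast
    then obtain r where r: "s = [:- l, 1:] * r" by (metis poly_eq_0_iff_dvd dvdE)
    have "r \<noteq> 0" using r Suc.prems by auto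
    moreover from this have "n = degree r"
      using Suc.hyps(2) degree_mult_eq[of "[:- l, 1:]" r] r by simp
    ultimately obtain q where q: "\<And>u. poly_mat T r *v u = 0 \<Longrightarrow> B *v u = poly_mat T q *v u"
      using Suc.hyps(1)[of r] by blast
    have s: "poly_mat T s *v u = T *v (poly_mat T r *v u) - l *s (poly_mat T r *v u)" for u
    proof -
      have "mat (- l) + T ** mat 1 = T - mat l"
        unfolding matrix_mul_rid by (simp add: vec_eq_iff mat_def)
      then have "poly_mat T s = (T - mat l) ** poly_mat T r"
        by (simp only: r poly_mat_mult) simp
      then show ?thesis
        by (simp add: matrix_vector_mul_assoc[symmetric] matrix_vector_mult_diff_rdistrib)
    qed
    show ?case
    proof (cases "\<exists>w. poly_mat T s *v w = 0 \<and> poly_mat T r *v w \<noteq> 0")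
      case False
      then show ?thesis using q by blast
    next
      case True
      then obtain w where w: "poly_mat T s *v w = 0" "poly_mat T r *v w \<noteq> 0" by blast
      define v where "v = poly_mat T r *v w"
      have v: "v \<noteq> 0" "T *v v = l *s v" using w s[of w] by (auto simp: v_def)
      \<comment> \<open>\<open>B'\<close> commutes with \<open>T\<close> and kills
        \<open>ker r(T)\<close>, which contains \<open>T w - l w\<close>. Hence \<open>B' w\<close>
        lies in the \<open>l\<close>-eigenspace, the line spanned by \<open>v\<close>.\<close>
      define B' where "B' = B - poly_mat T q"
      have q': "B' *v u = 0" if "poly_mat T r *v u = 0" for u
        using q[OF that] by (simp add: B'_def matrix_vector_mult_diff_rdistrib)
      have B'T: "B' ** T = T ** B'"
        by (simp add: B'_def matrix_sub_ldistrib matrix_sub_rdistrib comm poly_mat_commute)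
      have "poly_mat T r *v (T *v w - l *s w) = poly_mat T s *v w"
        by (simp add: s matrix_vector_mult_diff_distrib vector_scalar_commute
            matrix_vector_mul_assoc poly_mat_commute)
      then have "B' *v (T *v w - l *s w) = 0" using w q' by simp
      then have "T *v (B' *v w) = l *s (B' *v w)"
        by (simp add: matrix_vector_mult_diff_distrib vector_scalar_commute
            matrix_vector_mul_assoc B'T)
      then obtain c where c: "B' *v w = c *s v"
        using nd v unfolding nonderogatory_def by blast
      \<comment> \<open>If \<open>r(T) u = a v\<close>, then \<open>u - a w\<close> lies in
        \<open>ker r(T)\<close>, so \<open>B' u = a c v = c r(T) u\<close>: adding
        \<open>c r\<close> to \<open>q\<close> repairs the discrepancy on all of
        \<open>ker s(T)\<close>.\<close>
      have "B *v u = poly_mat T (q + smult c r) *v u" if u: "poly_mat T s *v u = 0" for u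
      proof -
        have "T *v (poly_mat T r *v u) = l *s (poly_mat T r *v u)" using s[of u] u by simp
        then obtain a where a: "poly_mat T r *v u = a *s v"
          using nd v unfolding nonderogatory_def by blast
        then have "poly_mat T r *v (u - a *s w) = 0"
          by (simp add: matrix_vector_mult_diff_distrib vector_scalar_commute v_def)
        then have "B' *v u = a *s (B' *v w)"
          using q' by (fastforce simp: matrix_vector_mult_diff_distrib vector_scalar_commute)
        also have "\<dots> = c *s (poly_mat T r *v u)"
          by (simp add: c a vector_smult_assoc mult.commute)
        finally show ?thesis
          by (simp add: B'_def poly_mat_add poly_mat_smult matrix_vector_mult_diff_rdistrib
              matrix_vector_mult_add_rdistrib matrix_vector_mul_assoc[symmetric] algebra_simps)
      qed
      then show ?thesis by blast
    qed
  qed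
  obtain p where "p \<noteq> 0" "poly_mat T p = 0" using ex_annihilating_poly by blast
  then obtain q where "\<forall>u. B *v u = poly_mat T q *v u" using step[of p] by auto
  then show ?thesis using matrix_eq by blast
qed

text \<open>Injectivity of the commutator with \<open>T\<close> on antisymmetric matrices: the
  source of the lower bound for pencils and of the final vanishing of the constant solution.\<close>

lemma antisymmetric_commuting_zero:
  assumes "nonderogatory T" "transpose T = T" "transpose X = - X" "T ** X = X ** T"
  shows "X = 0"
proof -
  obtain q where "X = poly_mat T q" using nonderogatory_commutant assms by blast
  then have "X = - X" using transpose_poly_mat[OF assms(2)] assms(3) by metis
  then show ?thesis by (simp add: vec_eq_iff)
qed

section \<open>Solving [T, Y] = N by orthogonality\<close>

definition cnj_mat :: "complex^'n^'m \<Rightarrow> complex^'n^'m" where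
  "cnj_mat A = (\<chi> i j. cnj (A $ i $ j))"

lemma inner_matrix_conv_trace: "inner A B = Re (trace (transpose (cnj_mat A) ** B))"
  for A B :: "complex^'n^'n"
proof -
  have "inner A B = (\<Sum>i\<in>UNIV. \<Sum>j\<in>UNIV. Re (cnj (A $ i $ j) * B $ i $ j))"
    by (simp add: inner_vec_def inner_complex_def)
  also have "\<dots> = (\<Sum>j\<in>UNIV. \<Sum>i\<in>UNIV. Re (cnj (A $ i $ j) * B $ i $ j))"
    by (rule sum.swap)
  finally show ?thesis
    by (simp add: trace_def matrix_matrix_mult_def transpose_def cnj_mat_def)
qed

text \<open>With respect to the trace form, the image of \<open>ad T\<close> on the antisymmetric matrices is the
  orthogonal complement, among the symmetric matrices, of the commutant of \<open>T\<close>.\<close>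

lemma ex_antisymmetric_commutator:
  assumes nd: "nonderogatory T" and T: "transpose T = T" and N: "transpose N = N"
    and tr: "\<And>q. trace (poly_mat T q ** N) = 0"
  shows "\<exists>Y. transpose Y = - Y \<and> T ** Y - Y ** T = N"
proof -
  define V where "V = {T ** Y - Y ** T | Y. transpose Y = - Y}"
  have scaleR: "T ** (c *\<^sub>R Y) = c *\<^sub>R (T ** Y)" "(c *\<^sub>R Y) ** T = c *\<^sub>R (Y ** T)" for c :: real and Y
    by (simp_all add: vec_eq_iff matrix_matrix_mult_def scaleR_right.sum)

  have "subspace V"
    unfolding subspace_def
  proof (intro conjI ballI allI)
    show "0 \<in> V" unfolding V_def by (rule CollectI, rule exI[of _ 0]) (simp add: transpose_def vec_eq_iff)
  next
    fix a b assume "a \<in> V" "b \<in> V"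
    then obtain Y Z where "a = T ** Y - Y ** T" "transpose Y = - Y"
       "b = T ** Z - Z ** T" "transpose Z = - Z" by (auto simp: V_def)
    then show "a + b \<in> V" unfolding V_def
      by (intro CollectI exI[of _ "Y + Z"]) (simp add: transpose_add matrix_add_ldistrib matrix_add_rdistrib)
  next
    fix c :: real and a assume "a \<in> V"
    then obtain Y where "a = T ** Y - Y ** T" "transpose Y = - Y" by (auto simp: V_def)
    then show "c *\<^sub>R a \<in> V" unfolding V_def
      by (intro CollectI exI[of _ "c *\<^sub>R Y"]) (simp add: scaleR scaleR_diff_right transpose_scalar)
  qed
  \<comment> \<open>\<open>u\<close> is the component of \<open>N\<close> orthogonal to the image
    \<open>V\<close>; the rest of the proof shows that it vanishes.\<close>
  then obtain v u where v: "v \<in> V" and u: "\<And>w. w \<in> V \<Longrightarrow> inner u w = 0" and Nvu: "N = v + u"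
    using orthogonal_subspace_decomp_exists[of V N] span_eq_iff[of V]
    by (metis orthogonal_def)
  obtain Y where Y: "v = T ** Y - Y ** T" "transpose Y = - Y" using v by (auto simp: V_def)
  have neg: "(- A) ** C = - (A ** C)" "A ** (- C) = - (A ** C)" for A C :: "complex^'n^'n"
    by (simp_all add: vec_eq_iff matrix_matrix_mult_def sum_negf)
  have "transpose v = v"
    using Y T by (simp add: transpose_diff matrix_transpose_mul neg)
  then have u_sym: "transpose u = u" using N Nvu by (simp add: transpose_add)
  \<comment> \<open>Conjugation turns the inner product with \<open>u\<close> into the real part of
    the trace form with \<open>B\<close>.\<close>
  define B where "B = cnj_mat u"
  have B: "transpose B = B" using u_sym by (simp add: B_def cnj_mat_def transpose_def vec_eq_iff)
  have inner_u: "inner u w = Re (trace (B ** w))" for w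
    using B by (simp add: inner_matrix_conv_trace B_def)
  \<comment> \<open>By cyclicity of the trace, orthogonality of \<open>u\<close> to \<open>V\<close>
    says Re tr(K Z) = 0 for all antisymmetric \<open>Z\<close>. Since \<open>K\<close> is
    antisymmetric, \<open>Z = cnj_mat K\<close> is allowed and gives |K|^2 = 0.\<close>
  define K where "K = B ** T - T ** B"
  have K: "transpose K = - K" using B T by (simp add: K_def transpose_diff matrix_transpose_mul)
  have KY: "Re (trace (K ** Z)) = 0" if "transpose Z = - Z" for Z
  proof -
    have "trace (B ** (T ** Z - Z ** T)) = trace (B ** T ** Z) - trace (B ** (Z ** T))"
      by (simp add: matrix_sub_ldistrib trace_sub matrix_mul_assoc)
    also have "trace (B ** (Z ** T)) = trace (T ** B ** Z)"
      by (metis matrix_mul_assoc trace_mul_sym)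
    finally have "trace (B ** (T ** Z - Z ** T)) = trace (K ** Z)"
      by (simp add: K_def matrix_sub_rdistrib trace_sub)
    then show ?thesis using inner_u[of "T ** Z - Z ** T"] u[of "T ** Z - Z ** T"] that
      by (auto simp: V_def)
  qed
  have "transpose (cnj_mat K) = - cnj_mat K"
  proof -
    have "transpose (cnj_mat K) = cnj_mat (transpose K)"
      by (simp add: vec_eq_iff transpose_def cnj_mat_def)
    also have "\<dots> = - cnj_mat K" by (simp add: K) (simp add: vec_eq_iff cnj_mat_def)
    finally show ?thesis .
  qed
  then have KK: "Re (trace (K ** cnj_mat K)) = 0" "transpose (cnj_mat K) ** K = - (cnj_mat K ** K)"
    using KY[of "cnj_mat K"] by (auto simp only: neg)
  have "trace (- (cnj_mat K ** K)) = - trace (K ** cnj_mat K)"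
    unfolding trace_mul_sym[of K] by (simp add: trace_def sum_negf)
  then have "inner K K = 0" using KK by (simp add: inner_matrix_conv_trace)
  then have "T ** B = B ** T" by (simp add: K_def)
  then obtain q where "B = poly_mat T q" using nonderogatory_commutant nd by blast
  \<comment> \<open>\<open>B\<close> being a polynomial in \<open>T\<close>, the trace hypothesis
    applies to it. Thus \<open>u\<close> is orthogonal to both \<open>N\<close> and
    \<open>v\<close>, hence to \<open>N - v = u\<close>.\<close>
  then have "inner u N = 0" using inner_u tr by simp
  then have "inner u u = 0" using u[OF v] Nvu by (simp add: inner_add_right)
  then have "N = v" using Nvu by simp
  then show ?thesis using Y by blast
qed

section \<open>The derivative of the determinant\<close>

text \<open>The directional derivative tr(adj(A) N) of \<open>det\<close> at \<open>A\<close>,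
  written by multilinearity in the rows so that it makes sense over any commutative ring, in
  particular \<open>poly3\<close>.\<close>

definition det_deriv :: "'a::comm_ring_1^'n^'n \<Rightarrow> 'a^'n^'n \<Rightarrow> 'a" where
  "det_deriv A N = (\<Sum>i\<in>UNIV. det (\<chi> k. if k = i then N $ i else A $ k))"

text \<open>A unit vector in row \<open>i\<close> produces the signed minor without deleting a row
  and a column, so the index type stays the same.\<close>

definition cofactor :: "'a::comm_ring_1^'n^'n \<Rightarrow> 'n \<Rightarrow> 'n \<Rightarrow> 'a" where
  "cofactor A i j = det (\<chi> k. if k = i then axis j 1 else A $ k)"

lemma det_replace_row:
  fixes A :: "'a::comm_ring_1^'n^'n"
  shows "det (\<chi> k. if k = i then v else A $ k) =
    (\<Sum>p | p permutes UNIV. of_int (sign p) * (v $ p i * (\<Prod>k\<in>UNIV - {i}. A $ k $ p k)))"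
  unfolding det_def
proof (intro sum.cong refl)
  fix p
  have "(\<Prod>k\<in>UNIV. (\<chi> k. if k = i then v else A $ k) $ k $ p k) =
      v $ p i * (\<Prod>k\<in>UNIV - {i}. (\<chi> k. if k = i then v else A $ k) $ k $ p k)"
    by (subst prod.remove[of _ i]) auto
  also have "(\<Prod>k\<in>UNIV - {i}. (\<chi> k. if k = i then v else A $ k) $ k $ p k) =
      (\<Prod>k\<in>UNIV - {i}. A $ k $ p k)"
    by (intro prod.cong) auto
  finally show "of_int (sign p) * (\<Prod>k\<in>UNIV. (\<chi> k. if k = i then v else A $ k) $ k $ p k) =
      of_int (sign p) * (v $ p i * (\<Prod>k\<in>UNIV - {i}. A $ k $ p k))" by simp
qed

lemma det_deriv_Leibniz:
  fixes A :: "'a::comm_ring_1^'n^'n"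
  shows "det_deriv A N =
    (\<Sum>p | p permutes UNIV. of_int (sign p) * (\<Sum>i\<in>UNIV. N $ i $ p i * (\<Prod>k\<in>UNIV - {i}. A $ k $ p k)))"
  unfolding det_deriv_def det_replace_row sum_distrib_left by (rule sum.swap)

lemma det_deriv_cofactor:
  fixes A :: "'a::comm_ring_1^'n^'n"
  shows "det_deriv A N = (\<Sum>i\<in>UNIV. \<Sum>j\<in>UNIV. N $ i $ j * cofactor A i j)"
  unfolding det_deriv_def
proof (intro sum.cong refl)
  fix i
  have "(\<Sum>j\<in>UNIV. N $ i $ j * cofactor A i j) =
      (\<Sum>j\<in>UNIV. \<Sum>p | p permutes UNIV. if p i = j
         then of_int (sign p) * (N $ i $ j * (\<Prod>k\<in>UNIV - {i}. A $ k $ p k)) else 0)"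
    unfolding cofactor_def det_replace_row sum_distrib_left
    by (intro sum.cong refl) (auto simp: axis_def)
  also have "\<dots> = (\<Sum>p | p permutes UNIV. of_int (sign p) * (N $ i $ p i * (\<Prod>k\<in>UNIV - {i}. A $ k $ p k)))"
    by (subst sum.swap) simp
  finally show "det (\<chi> k. if k = i then N $ i else A $ k) = (\<Sum>j\<in>UNIV. N $ i $ j * cofactor A i j)"
    by (simp only: det_replace_row)
qed

lemma det_deriv_add: "det_deriv A (M + N) = det_deriv A M + det_deriv A N"
  by (simp add: det_deriv_cofactor distrib_right sum.distrib)

lemma det_deriv_mat_mult: "det_deriv A (mat c ** N) = c * det_deriv A N"
  by (simp add: det_deriv_cofactor sum_distrib_left mult.assoc)

text \<open>Row \<open>i\<close> of \<open>C ** A\<close> is a combination of the rows of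
  \<open>A\<close>; substituted for row \<open>i\<close> of \<open>A\<close>, only its multiple
  \<open>C $ i $ i\<close> of that row contributes. This is Jacobi's formula without an
  inverse.\<close>

lemma det_deriv_mult_self:
  fixes A :: "'a::field^'n^'n"
  shows "det_deriv A (C ** A) = trace C * det A"
proof -
  have "det (\<chi> k. if k = i then (C ** A) $ i else A $ k) = C $ i $ i * det A" for i
  proof -
    have "(\<chi> k. if k = i then (C ** A) $ i else A $ k) =
        (\<chi> k. if k = i then (\<Sum>l\<in>UNIV. (C $ i) $ l *s row l A) else row k A)"
      by (simp add: vec_eq_iff row_def matrix_matrix_mult_def sum_component)
    then show ?thesis using cramer_lemma_transpose[of i "C $ i" A] by simp
  qed
  then show ?thesis by (simp add: det_deriv_def trace_def sum_distrib_right)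
qed

lemma det_eq_0_if_kernel:
  fixes A :: "'a::field^'n^'n"
  assumes "A *v u = 0" "u \<noteq> 0"
  shows "det A = 0"
  using assms by (metis invertible_det_nz invertible_left_inverse matrix_left_invertible_ker)

text \<open>Replacing one row imposes one new linear condition \<open>f\<close> on the kernel, which
  contains a plane; some nonzero vector of that plane satisfies it, so each summand is a singular
  determinant.\<close>

lemma det_deriv_eq_0_if_kernel:
  fixes A :: "'a::field^'n^'n"
  assumes "A *v v = 0" "A *v w = 0" "v \<noteq> 0" and indep: "\<And>c. w \<noteq> c *s v"
  shows "det_deriv A N = 0"
proof -
  have "det (\<chi> k. if k = i then N $ i else A $ k) = 0" for i
  proof -
    define f where "f u = (N *v u) $ i" for u
    have "\<exists>u. u \<noteq> 0 \<and> A *v u = 0 \<and> f u = 0"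
    proof (cases "f v = 0")
      case True
      then show ?thesis using assms by blast
    next
      case False
      define u where "u = w - (f w / f v) *s v"
      have "u \<noteq> 0" using indep by (auto simp: u_def)
      moreover have "A *v u = 0"
        using assms by (simp add: u_def matrix_vector_mult_diff_distrib vector_scalar_commute)
      moreover have "f u = 0"
        using False by (simp add: u_def f_def matrix_vector_mult_diff_distrib vector_scalar_commute)
      ultimately show ?thesis by blast
    qed
    then obtain u where u: "u \<noteq> 0" "A *v u = 0" "f u = 0" by blast
    have "((\<chi> k. if k = i then N $ i else A $ k) *v u) $ k = (if k = i then f u else (A *v u) $ k)" for k
      by (simp add: f_def matrix_vector_mult_def)
    then have "(\<chi> k. if k = i then N $ i else A $ k) *v u = 0"
      using u by (simp add: vec_eq_iff)
    then show ?thesis using det_eq_0_if_kernel u by blast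
  qed
  then show ?thesis by (simp add: det_deriv_def)
qed

lemma continuous_det_deriv_pencil:
  fixes T C :: "complex^'n^'n"
  shows "continuous_on UNIV (\<lambda>s. det_deriv (mat 1 + mat s ** T) C)"
  unfolding det_deriv_Leibniz vector_add_component mat_mult_nth
  by (intro continuous_intros)

text \<open>This is the expansion of the resolvent of \<open>T\<close> in traces of powers, freed of denominators.\<close>

lemma trace_poly_mat_eq_0:
  fixes T N :: "complex^'n^'n"
  assumes "\<And>s. s \<noteq> 0 \<Longrightarrow> det_deriv (mat 1 + mat s ** T) N = 0"
  shows "trace (poly_mat T q ** N) = 0"
  using assms
proof (induction q arbitrary: N)
  case 0
  then show ?case by (simp add: trace_def)
next
  case (pCons a q)
  define F where "F C s = det_deriv (mat 1 + mat s ** T) C" for C and s :: complex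
  have F0: "F N s = 0" if "s \<noteq> 0" for s using pCons.prems that by (simp add: F_def)
  \<comment> \<open>N (I + sT) = N + s NT, so \<open>det_deriv_mult_self\<close> links the function
    of \<open>N\<close> to that of \<open>N ** T\<close>, which is the direction for the
    induction.\<close>
  have rel: "F N s + s * F (N ** T) s = trace N * det (mat 1 + mat s ** T)" for s
  proof -
    have "N ** (mat 1 + mat s ** T) = N + mat s ** (N ** T)"
      by (metis matrix_add_ldistrib matrix_mul_assoc mat_mult_commute matrix_mul_rid)
    then show ?thesis
      unfolding F_def using det_deriv_mult_self[of "mat 1 + mat s ** T" N]
      by (simp add: det_deriv_add det_deriv_mat_mult)
  qed
  \<comment> \<open>Continuity supplies the value at s = 0, where \<open>rel\<close> reads tr N =
    0.\<close>
  have "(F N \<longlongrightarrow> F N 0) (at 0)"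
    using continuous_det_deriv_pencil[of T N]
    unfolding F_def[abs_def] continuous_on_def by blast
  moreover have "(F N \<longlongrightarrow> 0) (at 0)"
    by (rule tendsto_eventually) (auto simp: eventually_at F0 intro: exI[of _ 1])
  ultimately have "F N 0 = 0" using tendsto_unique trivial_limit_at by blast
  moreover have "mat 1 + mat 0 ** T = mat 1" by (simp add: vec_eq_iff)
  ultimately have tr: "trace N = 0" using rel[of 0] by simp
  \<comment> \<open>Here \<open>rel\<close> is divided by \<open>s\<close>; this is why the lemma
    assumes vanishing only for nonzero \<open>s\<close>.\<close>
  then have "F (N ** T) s = 0" if "s \<noteq> 0" for s using rel[of s] F0[OF that] that by simp
  then have "trace (poly_mat T q ** (N ** T)) = 0"
    using pCons.IH by (simp add: F_def)
  moreover have "trace (T ** poly_mat T q ** N) = trace (poly_mat T q ** (N ** T))"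
    by (metis matrix_mul_assoc trace_mul_sym)
  moreover have "trace (mat a ** N) = a * trace N"
    by (simp add: trace_def sum_distrib_left)
  ultimately show ?case
    using tr by (simp add: matrix_add_rdistrib trace_add)
qed

section \<open>Commutators with a pencil, and Liouville's theorem\<close>

definition commutator :: "complex^'n^'n \<Rightarrow> complex^'n^'n \<Rightarrow> complex^'n^'n" where
  "commutator A B = A ** B - B ** A"

lemma commutator_mat_mult_left: "commutator (mat c ** A) B = mat c ** commutator A B"
  and commutator_mat_mult_right: "commutator A (mat c ** B) = mat c ** commutator A B"
proof -
  have "B ** (mat c ** A) = mat c ** (B ** A)" for A B :: "complex^'n^'n"
    by (metis mat_mult_commute matrix_mul_assoc)
  then show "commutator (mat c ** A) B = mat c ** commutator A B"
    "commutator A (mat c ** B) = mat c ** commutator A B"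
    by (simp_all add: commutator_def matrix_sub_ldistrib matrix_mul_assoc[symmetric])
qed

lemma bounded_bilinear_commutator: "bounded_bilinear (commutator :: complex^'n^'n \<Rightarrow> _)"
proof -
  have "commutator (c *\<^sub>R A) B = c *\<^sub>R commutator A B"
       "commutator A (c *\<^sub>R B) = c *\<^sub>R commutator A B" for c and A B :: "complex^'n^'n"
    by (simp_all add: commutator_def vec_eq_iff matrix_matrix_mult_def scaleR_right.sum
        scaleR_diff_right)
  moreover have "commutator (A + C) B = commutator A B + commutator C B"
       "commutator A (B + C) = commutator A B + commutator A C" for A B C :: "complex^'n^'n"
    by (simp_all add: commutator_def matrix_add_ldistrib matrix_add_rdistrib)
  ultimately have "bilinear (commutator :: complex^'n^'n \<Rightarrow> _)"
    by (simp add: bilinear_def linear_iff)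
  then show ?thesis by (simp add: bilinear_conv_bounded_bilinear)
qed

interpretation commutator: bounded_bilinear commutator
  by (rule bounded_bilinear_commutator)

text \<open>Complex scalars act through products with scalar matrices, since \<open>scaleR\<close>
  covers only real ones.\<close>

definition pencil :: "complex^'n^'n \<Rightarrow> complex^'n^'n \<Rightarrow> complex \<Rightarrow> complex \<Rightarrow> complex^'n^'n" where
  "pencil D R x y = mat x ** D + mat y ** R"

lemma transpose_mat_mult: "transpose (mat c ** A) = mat c ** transpose A"
  for A :: "complex^'n^'n"
  by (simp add: vec_eq_iff transpose_def)

lemma transpose_pencil:
  "transpose D = D \<Longrightarrow> transpose R = R \<Longrightarrow> transpose (pencil D R x y) = pencil D R x y"
  by (simp add: pencil_def transpose_add transpose_mat_mult)

lemma bounded_linear_pencil: "bounded_linear (\<lambda>(x, y). pencil D R x y)"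
  by (intro linear_conv_bounded_linear[THEN iffD1] linearI)
     (auto simp: vec_eq_iff pencil_def algebra_simps scaleR_conv_of_real[where 'a = complex])

lemma pencil_scale: "pencil D R (c * x) (c * y) = mat c ** pencil D R x y"
  by (simp add: pencil_def vec_eq_iff algebra_simps)

text \<open>On the compact product of unit spheres the norm of the commutator is continuous and, by
  \<open>antisymmetric_commuting_zero\<close>, positive. Its minimum is \<open>c\<close>, and
  bilinearity rescales the estimate to all arguments.\<close>

lemma pencil_commutator_lower_bound:
  assumes sym: "transpose D = D" "transpose R = R"
    and nd: "\<And>x y. (x, y) \<noteq> (0, 0) \<Longrightarrow> nonderogatory (pencil D R x y)"
  shows "\<exists>c>0. \<forall>x y Y. transpose Y = - Y \<longrightarrow>
           c * norm (x, y) * norm Y \<le> norm (commutator (pencil D R x y) Y)"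
proof -
  define S :: "((complex \<times> complex) \<times> (complex^'a^'a)) set"
    where "S = sphere 0 1 \<times> (sphere 0 1 \<inter> {Y. transpose Y = - Y})"
  define g where "g = (\<lambda>(u, Y). norm (commutator (case u of (x, y) \<Rightarrow> pencil D R x y) Y))"
  have "closed {Y :: complex^'a^'a. transpose Y = - Y}"
    unfolding vec_eq_iff transpose_def
    by (simp, intro closed_Collect_all closed_Collect_eq continuous_intros)
  then have "compact S" unfolding S_def by (intro compact_Times compact_Int_closed compact_sphere)
  have cont: "continuous_on S g"
    unfolding g_def case_prod_unfold
    by (intro continuous_on_norm commutator.continuous_on continuous_on_snd continuous_on_id
        bounded_linear.continuous_on[OF bounded_linear_pencil[unfolded case_prod_unfold]] continuous_on_fst)
  have pos: "g s > 0" if s: "s \<in> S" for s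
  proof -
    obtain x y Y where s_eq: "s = ((x, y), Y)" by (metis surj_pair)
    then have Y: "norm (x, y) = 1" "norm Y = 1" "transpose Y = - Y" using s by (auto simp: S_def)
    then have xy: "(x, y) \<noteq> (0, 0)" by (auto simp: zero_prod_def[symmetric])
    have "commutator (pencil D R x y) Y \<noteq> 0"
    proof
      assume "commutator (pencil D R x y) Y = 0"
      then have "pencil D R x y ** Y = Y ** pencil D R x y" by (simp add: commutator_def)
      then have "Y = 0"
        using antisymmetric_commuting_zero nd[OF xy] transpose_pencil[OF sym] Y(3) by blast
      then show False using Y by simp
    qed
    then show ?thesis by (simp add: g_def s_eq)
  qed
  obtain c where c: "c > 0" "\<And>s. s \<in> S \<Longrightarrow> c \<le> g s"
  proof (cases "S = {}")
    \<comment> \<open>This happens for 1 x 1 matrices, where 0 is the only antisymmetric one; any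
      positive constant will do.\<close>
    case True
    then show ?thesis using that[of 1] by simp
  next
    case False
    then obtain s where "s \<in> S" "\<forall>r\<in>S. g s \<le> g r"
      using continuous_attains_inf[OF \<open>compact S\<close> _ cont] by blast
    then show ?thesis using that[of "g s"] pos by blast
  qed
  have "c * norm (x, y) * norm Y \<le> norm (commutator (pencil D R x y) Y)"
    if "transpose Y = - Y" for x y Y
  proof (cases "(x, y) = (0, 0) \<or> Y = 0")
    case True
    then show ?thesis by (auto simp: zero_prod_def[symmetric])
  next
    case False
    define a where "a = inverse (norm (x, y))"
    define b where "b = inverse (norm Y)"
    have ab: "a > 0" "b > 0" using False by (auto simp: a_def b_def zero_prod_def)
    have "transpose (b *\<^sub>R Y) = - (b *\<^sub>R Y)"
      using that by (simp add: transpose_scalar)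
    moreover have "norm (a *\<^sub>R (x, y)) = 1" "norm (b *\<^sub>R Y) = 1"
      using False unfolding a_def b_def norm_scaleR by (simp_all add: zero_prod_def)
    ultimately have "(a *\<^sub>R (x, y), b *\<^sub>R Y) \<in> S"
      by (simp only: S_def mem_Times_iff fst_conv snd_conv mem_sphere_0 Int_iff mem_Collect_eq)
    then have "c \<le> g (a *\<^sub>R (x, y), b *\<^sub>R Y)" by (rule c)
    also have "\<dots> = a * b * norm (commutator (pencil D R x y) Y)"
    proof -
      have "(case a *\<^sub>R (x, y) of (x, y) \<Rightarrow> pencil D R x y) = a *\<^sub>R pencil D R x y"
        using linear_scale[OF bounded_linear.linear[OF bounded_linear_pencil], of D R a "(x, y)"]
        by simp
      then show ?thesis
        unfolding g_def prod.case using ab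
        by (simp add: commutator.scaleR_left commutator.scaleR_right)
    qed
    finally show ?thesis using False ab by (simp add: a_def b_def field_simps zero_prod_def)
  qed
  with c(1) show ?thesis by blast
qed

text \<open>A solution \<open>Y\<close> of \<open>[xD + yR, Y] = xD' + yR'\<close> is unique and homogeneous of degree \<open>0\<close> in
  \<open>(x, y)\<close>, hence a bounded entire function of \<open>z = y/x\<close>, hence constant.\<close>

lemma commutator_pencil_solution_constant:
  assumes sym: "transpose D = D" "transpose R = R"
    and nd: "\<And>x y. (x, y) \<noteq> (0, 0) \<Longrightarrow> nonderogatory (pencil D R x y)"
    and Y: "\<And>z. transpose (Y z) = - Y z"
      "\<And>z. commutator (pencil D R 1 z) (Y z) = pencil D' R' 1 z"
  shows "\<exists>X. \<forall>z. Y z = X"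
proof -
  obtain c where c: "c > 0" "\<And>x y A. transpose A = - A \<Longrightarrow>
      c * norm (x, y) * norm A \<le> norm (commutator (pencil D R x y) A)"
    using pencil_commutator_lower_bound[OF sym nd] by blast
  have c1: "norm A \<le> norm (commutator (pencil D R 1 z) A) / c" if "transpose A = - A" for z A
  proof -
    have "1 \<le> norm (1 :: complex, z)" by (metis norm_fst_le fst_conv norm_one)
    then have "c * 1 * norm A \<le> c * norm (1 :: complex, z) * norm A"
      using c(1) by (intro mult_right_mono mult_left_mono) auto
    also have "\<dots> \<le> norm (commutator (pencil D R 1 z) A)" using c(2) that by blast
    finally show ?thesis using c(1) by (simp add: field_simps)
  qed
  obtain K where K: "\<And>u. norm (case u of (x, y) \<Rightarrow> pencil D' R' x y) \<le> norm u * K"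
    using bounded_linear.bounded[OF bounded_linear_pencil] by blast
  \<comment> \<open>Both sides of the estimate grow linearly in \<open>norm (1, z)\<close>, which
    cancels and leaves a bound uniform in \<open>z\<close>.\<close>
  have Y_bound: "norm (Y z) \<le> K / c" for z
  proof -
    have "c * norm (1 :: complex, z) * norm (Y z) \<le> norm (pencil D' R' 1 z)"
      using c(2)[of "Y z" 1 z] Y by simp
    also have "\<dots> \<le> norm (1 :: complex, z) * K" using K[of "(1, z)"] by simp
    finally have "norm (1 :: complex, z) * (c * norm (Y z)) \<le> norm (1 :: complex, z) * K"
      by (simp add: mult_ac)
    then have "c * norm (Y z) \<le> K"
      by (subst (asm) mult_le_cancel_left_pos) (auto simp: zero_prod_def)
    then show ?thesis using c(1) by (simp add: field_simps)
  qed
  have deriv: "\<exists>q. \<forall>i j. ((\<lambda>z. Y z $ i $ j) has_field_derivative q $ i $ j) (at w)" for w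
  proof -
    \<comment> \<open>Subtracting the equations at \<open>z\<close> and \<open>w\<close> shows that
      the difference quotient \<open>Q z\<close> solves [T(1,z), Q z] = C with \<open>C\<close>
      independent of \<open>z\<close>; by \<open>c1\<close> it stays bounded as \<open>z\<close>
      tends to \<open>w\<close>.\<close>
    define Q where "Q z = mat (1 / (z - w)) ** (Y z - Y w)" for z
    define C where "C = R' - commutator R (Y w)"
    have antisym: "transpose (Q z) = - Q z" for z
      using Y(1) unfolding Q_def
      by (simp add: transpose_mat_mult transpose_diff) (simp add: vec_eq_iff algebra_simps)
    have pencil_diff: "pencil A B 1 z - pencil A B 1 w = mat (z - w) ** B" for A B :: "complex^'a^'a" and z
      by (simp add: pencil_def vec_eq_iff algebra_simps)
    have comm_Q: "commutator (pencil D R 1 z) (Q z) = C" if "z \<noteq> w" for z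
    proof -
      have "commutator (pencil D R 1 z) (Y z - Y w)
          = (pencil D' R' 1 z - pencil D' R' 1 w) - commutator (pencil D R 1 z - pencil D R 1 w) (Y w)"
        by (simp add: commutator.diff_left commutator.diff_right Y(2))
      also have "\<dots> = mat (z - w) ** C"
        by (simp add: pencil_diff C_def commutator_mat_mult_left matrix_sub_ldistrib)
      finally show ?thesis
        using that by (simp add: Q_def commutator_mat_mult_right) (simp add: vec_eq_iff)
    qed
    have cont_pencil: "isCont (\<lambda>z. pencil D R 1 z) w"
    proof -
      have "isCont (\<lambda>z. (\<lambda>(x, y). pencil D R x y) (1, z)) w"
        by (intro bounded_linear.isCont[OF bounded_linear_pencil] continuous_intros)
      then show ?thesis by simp
    qed
    define s where "s n = w + of_real (inverse (real (Suc n)))" for n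
    have s: "s \<longlonglongrightarrow> w" "s n \<noteq> w" for n
    proof -
      have "s \<longlonglongrightarrow> w + of_real 0"
        unfolding s_def by (intro tendsto_intros LIMSEQ_inverse_real_of_nat)
      then show "s \<longlonglongrightarrow> w" by simp
      show "s n \<noteq> w" by (simp add: s_def del: of_nat_Suc)
    qed
    have "Q (s n) \<in> cball 0 (norm C / c)" for n
      using c1[OF antisym, of "s n" "s n"] comm_Q[OF s(2)] by simp

    \<comment> \<open>Bolzano-Weierstrass yields a candidate \<open>q\<close> for the derivative,
      which in the limit solves [T(1,w), q] = C.\<close>
    then obtain q r where r: "strict_mono r" "((\<lambda>n. Q (s n)) \<circ> r) \<longlonglongrightarrow> q"
      using compact_cball[of 0 "norm C / c", unfolded compact_def, rule_format, of "\<lambda>n. Q (s n)"]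
      by blast
    have sr: "(s \<circ> r) \<longlonglongrightarrow> w" using s(1) r(1) LIMSEQ_subseq_LIMSEQ by blast
    have "(\<lambda>n. commutator (pencil D R 1 ((s \<circ> r) n)) (((\<lambda>n. Q (s n)) \<circ> r) n))
        \<longlonglongrightarrow> commutator (pencil D R 1 w) q"
      using isCont_tendsto_compose[OF cont_pencil sr] r(2) by (rule commutator.tendsto)
    moreover have "commutator (pencil D R 1 ((s \<circ> r) n)) (((\<lambda>n. Q (s n)) \<circ> r) n) = C" for n
      using comm_Q s(2) by simp
    ultimately have q: "commutator (pencil D R 1 w) q = C"
      by (simp add: LIMSEQ_const_iff)
    have "transpose q = - q"
    proof -
      have q_nth: "q $ j $ i = - q $ i $ j" for i j
      proof (rule LIMSEQ_unique)
        show "(\<lambda>n. Q (s (r n)) $ j $ i) \<longlonglongrightarrow> q $ j $ i"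
          using r(2) by (intro tendsto_vec_nth) (simp add: o_def)
        have "(\<lambda>n. - Q (s (r n)) $ i $ j) \<longlonglongrightarrow> - q $ i $ j"
          using r(2) by (intro tendsto_minus tendsto_vec_nth) (simp add: o_def)
        moreover have "- Q z $ i $ j = Q z $ j $ i" for z
          using arg_cong[OF antisym[of z], of "\<lambda>A. A $ i $ j"] by (simp add: transpose_def)
        ultimately show "(\<lambda>n. Q (s (r n)) $ j $ i) \<longlonglongrightarrow> - q $ i $ j" by simp
      qed
      show ?thesis by (simp add: vec_eq_iff transpose_def, intro allI, rule q_nth)
    qed
    then have "transpose (Q z - q) = - (Q z - q)" for z using antisym by (simp add: transpose_diff)
    \<comment> \<open>The subsequential limit becomes a full limit: the commutator of T(1,z) with
      \<open>Q z - q\<close> equals [T(1,w) - T(1,z), q], which tends to 0, and \<open>c1\<close>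
      controls \<open>Q z - q\<close> by it.\<close>
    then have "norm (Q z - q) \<le> norm (commutator (pencil D R 1 z) (Q z - q)) / c" for z
      by (rule c1)
    moreover have "commutator (pencil D R 1 z) (Q z - q)
        = commutator (pencil D R 1 w - pencil D R 1 z) q" if "z \<noteq> w" for z
      using comm_Q[OF that] q by (simp add: commutator.diff_left commutator.diff_right)
    ultimately have bound: "norm (Q z - q)
        \<le> norm (commutator (pencil D R 1 w - pencil D R 1 z) q) / c" if "z \<noteq> w" for z
      using that by metis
    have "((\<lambda>z. norm (commutator (pencil D R 1 w - pencil D R 1 z) q) / c) \<longlongrightarrow>
        norm (commutator (pencil D R 1 w - pencil D R 1 w) q) / c) (at w)"
      using cont_pencil c(1) unfolding isCont_def
      by (intro tendsto_intros commutator.tendsto) auto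
    then have "((\<lambda>z. norm (commutator (pencil D R 1 w - pencil D R 1 z) q) / c) \<longlongrightarrow> 0) (at w)"
      by (simp add: commutator.zero_left)
    then have "((\<lambda>z. Q z - q) \<longlongrightarrow> 0) (at w)"
      by (rule Lim_null_comparison[rotated]) (auto simp: eventually_at bound intro: exI[of _ 1])
    then have "(Q \<longlongrightarrow> q) (at w)" by (simp add: LIM_zero_iff)
    then have "((\<lambda>z. Q z $ i $ j) \<longlongrightarrow> q $ i $ j) (at w)" for i j by (intro tendsto_vec_nth)
    then show ?thesis
      unfolding has_field_derivative_iff by (intro exI[of _ q]) (simp add: Q_def)
  qed
  have "Y z = Y 0" for z
  proof -
    have "Y z $ i $ j = Y 0 $ i $ j" for i j
    proof -
      have "(\<lambda>z. Y z $ i $ j) holomorphic_on UNIV"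
        unfolding holomorphic_on_def field_differentiable_def
        using deriv by (metis has_field_derivative_at_within)
      moreover have "bounded (range (\<lambda>z. Y z $ i $ j))"
      proof (rule boundedI)
        fix a assume "a \<in> range (\<lambda>z. Y z $ i $ j)"
        then obtain z where "a = Y z $ i $ j" by blast
        then show "norm a \<le> K / c"
          using Finite_Cartesian_Product.norm_nth_le[of "Y z $ i" j]
            Finite_Cartesian_Product.norm_nth_le[of "Y z" i] Y_bound[of z] by simp
      qed
      ultimately have "(\<lambda>z. Y z $ i $ j) constant_on UNIV" by (rule Liouville_theorem)
      then show ?thesis by (auto simp: constant_on_def)
    qed
    then show ?thesis by (simp add: vec_eq_iff)
  qed
  then show ?thesis by blast
qed

text \<open>Evaluating the constant solution at z = 0 and z = 1 separates \<open>D'\<close> from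
  \<open>R'\<close>. The point (1,0) makes the diagonal matrix \<open>D\<close> nonderogatory, so an
  antisymmetric matrix commuting with it vanishes.\<close>

lemma pencil_rigidity:
  assumes diag: "\<And>i j. i \<noteq> j \<Longrightarrow> D $ i $ j = 0" "\<And>i j. i \<noteq> j \<Longrightarrow> D' $ i $ j = 0"
    and sym: "transpose R = R"
    and nd: "\<And>x y. (x, y) \<noteq> (0, 0) \<Longrightarrow> nonderogatory (pencil D R x y)"
    and ex: "\<And>x y. (x, y) \<noteq> (0, 0) \<Longrightarrow>
      \<exists>Y. transpose Y = - Y \<and> commutator (pencil D R x y) Y = pencil D' R' x y"
  shows "D' = 0" "R' = 0"
proof -
  have symD: "transpose D = D" using diag(1) by (simp add: vec_eq_iff transpose_def) metis
  have "\<forall>z. \<exists>Y. transpose Y = - Y \<and> commutator (pencil D R 1 z) Y = pencil D' R' 1 z"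
    using ex[of 1] by simp
  from choice[OF this] obtain Y where Y: "\<And>z. transpose (Y z) = - Y z"
      "\<And>z. commutator (pencil D R 1 z) (Y z) = pencil D' R' 1 z"
    by blast
  then obtain X where "\<And>z. Y z = X"
    using commutator_pencil_solution_constant[OF symD sym nd] by blast
  then have X: "transpose X = - X" "\<And>z. commutator (pencil D R 1 z) X = pencil D' R' 1 z"
    using Y by auto
  have pencil_0: "pencil A B 1 0 = A" and pencil_1: "pencil A B 1 1 = A + B"
    for A B :: "complex^'a^'a"
    by (simp_all add: pencil_def vec_eq_iff)
  have DX: "commutator D X = D'" using X(2)[of 0] by (simp add: pencil_0)
  have "D' $ i $ i = 0" for i
  proof -
    have "(\<Sum>k\<in>UNIV. D $ i $ k * X $ k $ i) = (\<Sum>k\<in>UNIV. X $ i $ k * D $ k $ i)"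
      by (intro sum.cong refl) (metis diag(1) mult.commute mult_zero_left)
    then show ?thesis
      by (simp add: DX[symmetric] commutator_def matrix_matrix_mult_def)
  qed
  then show "D' = 0" using diag(2) by (metis vec_eq_iff zero_index)
  then have "D ** X = X ** D" using DX by (simp add: commutator_def)
  moreover have "nonderogatory D" using nd[of 1 0] by (simp add: pencil_0)
  ultimately have "X = 0" using antisymmetric_commuting_zero symD X(1) by blast
  then show "R' = 0"
    using X(2)[of 1] \<open>D' = 0\<close> by (simp add: pencil_1 commutator.zero_right)
qed

section \<open>Evaluation, coefficients and homogeneity in three variables\<close>

lemma eval3_add: "eval3 (p + q) t x y = eval3 p t x y + eval3 q t x y"
  and eval3_diff: "eval3 (p - q) t x y = eval3 p t x y - eval3 q t x y"
  and eval3_mult: "eval3 (p * q) t x y = eval3 p t x y * eval3 q t x y"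
  and eval3_0: "eval3 0 t x y = 0"
  and eval3_1: "eval3 1 t x y = 1"
  and eval3_of_int: "eval3 (of_int n) t x y = of_int n"
  and eval3_var: "eval3 var_t t x y = t" "eval3 var_x t x y = x" "eval3 var_y t x y = y"
  and eval3_const3: "eval3 (const3 c) t x y = c"
  and eval3_sum: "eval3 (sum f A) t x y = (\<Sum>a\<in>A. eval3 (f a) t x y)"
  and eval3_prod: "eval3 (prod f A) t x y = (\<Prod>a\<in>A. eval3 (f a) t x y)"
  by (simp_all add: eval3_def var_t_def var_x_def var_y_def const3_def poly_sum poly_prod)

definition eval3_mat :: "poly3^'n^'n \<Rightarrow> complex \<Rightarrow> complex \<Rightarrow> complex \<Rightarrow> complex^'n^'n" where
  "eval3_mat P t x y = (\<chi> i j. eval3 (P $ i $ j) t x y)"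

lemma eval3_det: "eval3 (det P) t x y = det (eval3_mat P t x y)"
  by (simp add: det_def eval3_sum eval3_mult eval3_of_int eval3_prod eval3_mat_def)

lemma eval3_det_deriv:
  "eval3 (det_deriv P N) t x y = det_deriv (eval3_mat P t x y) (eval3_mat N t x y)"
  by (simp add: det_deriv_Leibniz eval3_sum eval3_mult eval3_of_int eval3_prod eval3_mat_def)

lemma coeff3_eqI: "(\<And>i j k. coeff3 p i j k = coeff3 q i j k) \<Longrightarrow> p = q"
  by (simp add: coeff3_def poly_eq_iff)

lemma coeff3_add: "coeff3 (p + q) i j k = coeff3 p i j k + coeff3 q i j k"
  and coeff3_diff: "coeff3 (p - q) i j k = coeff3 p i j k - coeff3 q i j k"
  and coeff3_0: "coeff3 0 i j k = 0"
  and coeff3_sum: "coeff3 (sum f A) i j k = (\<Sum>a\<in>A. coeff3 (f a) i j k)"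
  by (simp_all add: coeff3_def coeff_sum)

lemma coeff3_mult: "coeff3 (p * q) i j k =
    (\<Sum>a\<le>i. \<Sum>b\<le>j. \<Sum>c\<le>k. coeff3 p a b c * coeff3 q (i - a) (j - b) (k - c))"
  by (simp add: coeff3_def coeff_mult coeff_sum)

lemma coeff3_const3_mult: "coeff3 (const3 c * p) i j k = c * coeff3 p i j k"
  by (simp add: coeff3_def const3_def)

lemma coeff3_var_mult_const3:
  "coeff3 (var_x * const3 c) i j k = (if (i, j, k) = (0, 1, 0) then c else 0)"
  "coeff3 (var_y * const3 c) i j k = (if (i, j, k) = (0, 0, 1) then c else 0)"
  by (auto simp: coeff3_def var_x_def var_y_def const3_def coeff_pCons split: nat.splits)

lemma coeff3_var_t: "coeff3 var_t i j k = (if (i, j, k) = (1, 0, 0) then 1 else 0)"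
  by (auto simp: coeff3_def var_t_def coeff_pCons split: nat.splits)

lemma homogeneous3_add:
  "homogeneous3 d p \<Longrightarrow> homogeneous3 d q \<Longrightarrow> homogeneous3 d (p + q)"
  and homogeneous3_diff:
  "homogeneous3 d p \<Longrightarrow> homogeneous3 d q \<Longrightarrow> homogeneous3 d (p - q)"
  unfolding homogeneous3_def coeff3_add coeff3_diff
  by (metis add_0) (metis diff_0_right diff_self)

lemma homogeneous3_0: "homogeneous3 d 0"
  by (simp add: homogeneous3_def coeff3_0)

lemma homogeneous3_sum:
  "(\<And>a. a \<in> A \<Longrightarrow> homogeneous3 d (f a)) \<Longrightarrow> homogeneous3 d (sum f A)"
  by (induction A rule: infinite_finite_induct) (simp_all add: homogeneous3_0 homogeneous3_add)

lemma homogeneous3_mult: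
  assumes "homogeneous3 d p" "homogeneous3 e q"
  shows "homogeneous3 (d + e) (p * q)"
  unfolding homogeneous3_def
proof (intro allI impI)
  fix i j k assume "coeff3 (p * q) i j k \<noteq> 0"
  then obtain a b c where abc: "a \<le> i" "b \<le> j" "c \<le> k"
      and "coeff3 p a b c * coeff3 q (i - a) (j - b) (k - c) \<noteq> 0"
    unfolding coeff3_mult by (metis (no_types, lifting) atMost_iff sum.neutral)
  then have "coeff3 p a b c \<noteq> 0" "coeff3 q (i - a) (j - b) (k - c) \<noteq> 0" by auto
  then have "a + b + c = d" "(i - a) + (j - b) + (k - c) = e"
    using assms unfolding homogeneous3_def by blast+
  then show "i + j + k = d + e" using abc by linarith
qed

lemma homogeneous3_of_int: "homogeneous3 0 (of_int n)"
proof -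
  have "of_int n = const3 (of_int n)" by (simp add: const3_def of_int_poly)
  then show ?thesis
    by (auto simp: homogeneous3_def coeff3_def const3_def coeff_pCons split: nat.splits)
qed

lemma homogeneous3_prod:
  assumes "finite A" "\<And>a. a \<in> A \<Longrightarrow> homogeneous3 1 (f a)"
  shows "homogeneous3 (card A) (prod f A)"
  using assms
proof (induction A rule: finite_induct)
  case empty
  then show ?case using homogeneous3_of_int[of 1] by simp
next
  case (insert a A)
  then show ?case using homogeneous3_mult[of 1 "f a" "card A" "prod f A"] by simp
qed

lemma homogeneous3_det:
  fixes P :: "poly3^'n^'n"
  assumes "\<And>i j. homogeneous3 1 (P $ i $ j)"
  shows "homogeneous3 CARD('n) (det P)"
  unfolding det_def
proof (intro homogeneous3_sum)
  fix p
  show "homogeneous3 CARD('n) (of_int (sign p) * (\<Prod>i\<in>UNIV. P $ i $ p i))"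
    using homogeneous3_mult[OF homogeneous3_of_int homogeneous3_prod[of UNIV "\<lambda>i. P $ i $ p i"]] assms
    by simp
qed

lemma homogeneous3_det_deriv:
  fixes P :: "poly3^'n^'n"
  assumes "\<And>i j. homogeneous3 1 (P $ i $ j)" "\<And>i j. homogeneous3 1 (N $ i $ j)"
  shows "homogeneous3 CARD('n) (det_deriv P N)"
  unfolding det_deriv_def
  by (intro homogeneous3_sum homogeneous3_det) (use assms in auto)

section \<open>Derivations applied to determinants\<close>

lemma derivation_prod:
  fixes \<delta> :: "'a::comm_ring_1 \<Rightarrow> 'a"
  assumes mult: "\<And>a b. \<delta> (a * b) = a * \<delta> b + \<delta> a * b" and "finite A"
  shows "\<delta> (prod f A) = (\<Sum>i\<in>A. \<delta> (f i) * (\<Prod>k\<in>A - {i}. f k))"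
  using \<open>finite A\<close>
proof (induction A rule: finite_induct)
  case empty
  show ?case using mult[of 1 1] by simp
next
  case (insert a A)
  have "(\<Prod>k\<in>insert a A - {i}. f k) = f a * (\<Prod>k\<in>A - {i}. f k)" if "i \<in> A" for i
    using that insert.hyps by (subst insert_Diff_if) auto
  then have "(\<Sum>i\<in>A. \<delta> (f i) * (\<Prod>k\<in>insert a A - {i}. f k)) = f a * \<delta> (prod f A)"
    unfolding insert.IH sum_distrib_left by (intro sum.cong) (simp_all add: mult_ac)
  moreover have "insert a A - {a} = A" using insert.hyps by auto
  ultimately show ?case using insert.hyps by (simp add: mult add.commute)
qed

text \<open>An abstract derivation lets one proof serve all three partial derivatives.\<close>

lemma derivation_det:
  fixes \<delta> :: "'a::comm_ring_1 \<Rightarrow> 'a" and P :: "'a^'n^'n"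
  assumes add: "\<And>a b. \<delta> (a + b) = \<delta> a + \<delta> b"
    and mult: "\<And>a b. \<delta> (a * b) = a * \<delta> b + \<delta> a * b"
  shows "\<delta> (det P) = det_deriv P (\<chi> i j. \<delta> (P $ i $ j))"
proof -
  have zero: "\<delta> 0 = 0" using add[of 0 0] by simp
  have neg: "\<delta> (- a) = - \<delta> a" for a
    using add[of a "- a"] zero by (metis add.right_inverse minus_unique)
  have sum: "\<delta> (sum f A) = (\<Sum>a\<in>A. \<delta> (f a))" for f :: "('n \<Rightarrow> 'n) \<Rightarrow> 'a" and A
    by (induction A rule: infinite_finite_induct) (simp_all add: zero add)
  have sign: "\<delta> (of_int (sign p) * a) = of_int (sign p) * \<delta> a" for p :: "'n \<Rightarrow> 'n" and a
    by (simp add: sign_def neg)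
  show ?thesis
    by (simp add: det_def sum sign derivation_prod[of \<delta>, OF mult] det_deriv_Leibniz)
qed

text \<open>A derivation of the coefficient ring lifts coefficientwise; one lift gives
  \<open>pderiv_x\<close>, two give \<open>pderiv_y\<close>.\<close>

lemma map_poly_derivation_mult:
  fixes p q :: "'a::comm_ring_1 poly"
  assumes "\<delta> 0 = 0" "\<And>a b. \<delta> (a + b) = \<delta> a + \<delta> b" "\<And>a b. \<delta> (a * b) = a * \<delta> b + \<delta> a * b"
  shows "map_poly \<delta> (p * q) = p * map_poly \<delta> q + map_poly \<delta> p * q"
proof (rule poly_eqI)
  fix n
  have "\<delta> (\<Sum>i\<in>A. f i) = (\<Sum>i\<in>A. \<delta> (f i))" for f :: "nat \<Rightarrow> _" and A
    by (induction A rule: infinite_finite_induct) (simp_all add: assms)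
  then show "coeff (map_poly \<delta> (p * q)) n = coeff (p * map_poly \<delta> q + map_poly \<delta> p * q) n"
    by (simp add: coeff_map_poly coeff_mult assms sum.distrib)
qed

lemma map_poly_add_additive:
  assumes "\<delta> 0 = 0" "\<And>a b. \<delta> (a + b) = \<delta> a + \<delta> b"
  shows "map_poly \<delta> (p + q) = map_poly \<delta> p + map_poly \<delta> q"
  by (rule poly_eqI) (simp add: coeff_map_poly assms)

lemma pderiv3_add:
  "pderiv_t (p + q) = pderiv_t p + pderiv_t q"
  "pderiv_x (p + q) = pderiv_x p + pderiv_x q"
  "pderiv_y (p + q) = pderiv_y p + pderiv_y q"
  by (simp_all add: pderiv_t_def pderiv_x_def pderiv_y_def pderiv_add map_poly_add_additive)

lemma pderiv3_mult:
  "pderiv_t (p * q) = p * pderiv_t q + pderiv_t p * q"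
  "pderiv_x (p * q) = p * pderiv_x q + pderiv_x p * q"
  "pderiv_y (p * q) = p * pderiv_y q + pderiv_y p * q"
proof -
  show "pderiv_t (p * q) = p * pderiv_t q + pderiv_t p * q"
    by (simp add: pderiv_t_def pderiv_mult mult.commute)
  show "pderiv_x (p * q) = p * pderiv_x q + pderiv_x p * q"
    unfolding pderiv_x_def
    by (intro map_poly_derivation_mult) (simp_all add: pderiv_add pderiv_mult mult.commute)
  show "pderiv_y (p * q) = p * pderiv_y q + pderiv_y p * q"
    unfolding pderiv_y_def
    by (intro map_poly_derivation_mult)
       (simp_all add: map_poly_add_additive map_poly_derivation_mult pderiv_add pderiv_mult mult.commute)
qed

section \<open>The determinantal map, its partial derivatives and the kernel of its
  differential\<close>

definition Phi_mat :: "(complex^'n^'n) \<times> (complex^'n^'n) \<Rightarrow> poly3^'n^'n" where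
  "Phi_mat = (\<lambda>(D, R).
     mat var_t + (\<chi> i j. var_x * const3 (D $ i $ j) + var_y * const3 (R $ i $ j)))"

text \<open>The linear part of the affine map \<open>Phi_mat\<close>, hence its differential at
  every point.\<close>

definition Phi_dir :: "(complex^'n^'n) \<times> (complex^'n^'n) \<Rightarrow> poly3^'n^'n" where
  "Phi_dir = (\<lambda>(D, R). \<chi> i j. var_x * const3 (D $ i $ j) + var_y * const3 (R $ i $ j))"

definition dPhi ::
  "(complex^'n^'n) \<times> (complex^'n^'n) \<Rightarrow> (complex^'n^'n) \<times> (complex^'n^'n) \<Rightarrow> poly3" where
  "dPhi v w = det_deriv (Phi_mat v) (Phi_dir w)"

lemma Phi_conv_det: "Phi v = det (Phi_mat v)"
  by (cases v) (simp add: Phi_def Phi_mat_def)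

lemma mat_nth: "mat c $ i $ j = (if i = j then c else 0)"
  by (simp add: mat_def)

lemma eval3_Phi_mat: "eval3_mat (Phi_mat (D, R)) t x y = mat t + pencil D R x y"
  by (simp add: eval3_mat_def Phi_mat_def pencil_def vec_eq_iff mat_nth eval3_add eval3_mult
      eval3_var eval3_const3 eval3_0)

lemma eval3_Phi_dir: "eval3_mat (Phi_dir (D, R)) t x y = pencil D R x y"
  by (simp add: eval3_mat_def Phi_dir_def pencil_def vec_eq_iff eval3_add eval3_mult
      eval3_var eval3_const3)

lemma eval3_Phi: "eval3 (Phi (D, R)) t x y = det (mat t + pencil D R x y)"
  by (simp add: Phi_conv_det eval3_det eval3_Phi_mat)

lemma eval3_dPhi:
  "eval3 (dPhi (D, R) (D', R')) t x y = det_deriv (mat t + pencil D R x y) (pencil D' R' x y)"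
  by (simp add: dPhi_def eval3_det_deriv eval3_Phi_mat eval3_Phi_dir)

lemma eval3_pderiv_Phi:
  "eval3 (pderiv_t (Phi (D, R))) t x y = det_deriv (mat t + pencil D R x y) (mat 1)"
  "eval3 (pderiv_x (Phi (D, R))) t x y = det_deriv (mat t + pencil D R x y) D"
  "eval3 (pderiv_y (Phi (D, R))) t x y = det_deriv (mat t + pencil D R x y) R"
proof -
  have 0: "pderiv_t 0 = 0" "pderiv_x 0 = 0" "pderiv_y 0 = 0"
    by (simp_all add: pderiv_t_def pderiv_x_def pderiv_y_def)
  have c: "pderiv_t (const3 a) = 0" "pderiv_x (const3 a) = 0" "pderiv_y (const3 a) = 0" for a
    by (simp_all add: pderiv_t_def pderiv_x_def pderiv_y_def const3_def pderiv_pCons map_poly_pCons)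
  have v: "pderiv_t var_t = 1" "pderiv_t var_x = 0" "pderiv_t var_y = 0"
    "pderiv_x var_t = 0" "pderiv_x var_x = 1" "pderiv_x var_y = 0"
    "pderiv_y var_t = 0" "pderiv_y var_x = 0" "pderiv_y var_y = 1"
    by (simp_all add: pderiv_t_def pderiv_x_def pderiv_y_def var_t_def var_x_def var_y_def
        pderiv_pCons map_poly_pCons one_pCons)
  note simps = pderiv3_add pderiv3_mult 0 c v
  have "eval3_mat (\<chi> i j. pderiv_t (Phi_mat (D, R) $ i $ j)) t x y = mat 1"
    "eval3_mat (\<chi> i j. pderiv_x (Phi_mat (D, R) $ i $ j)) t x y = D"
    "eval3_mat (\<chi> i j. pderiv_y (Phi_mat (D, R) $ i $ j)) t x y = R"
    by (simp_all add: eval3_mat_def Phi_mat_def mat_nth vec_eq_iff simps eval3_1 eval3_0 eval3_const3)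
  then show "eval3 (pderiv_t (Phi (D, R))) t x y = det_deriv (mat t + pencil D R x y) (mat 1)"
    "eval3 (pderiv_x (Phi (D, R))) t x y = det_deriv (mat t + pencil D R x y) D"
    "eval3 (pderiv_y (Phi (D, R))) t x y = det_deriv (mat t + pencil D R x y) R"
    unfolding Phi_conv_det
    by (simp_all add: derivation_det[of pderiv_t, OF pderiv3_add(1) pderiv3_mult(1)]
        derivation_det[of pderiv_x, OF pderiv3_add(2) pderiv3_mult(2)]
        derivation_det[of pderiv_y, OF pderiv3_add(3) pderiv3_mult(3)]
        eval3_det_deriv eval3_Phi_mat)
qed

text \<open>Where the corank of \<open>tI + xD + yR\<close> is at least two, all its first minors vanish, so
  \<open>(t, x, y)\<close> is a singular point of the curve.\<close>

lemma smooth_imp_nonderogatory: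
  assumes "smooth_curve (Phi (D, R))" and xy: "(x, y) \<noteq> (0, 0)"
  shows "nonderogatory (pencil D R x y)"
  unfolding nonderogatory_def
proof (intro allI impI, rule ccontr)
  fix l v w
  assume v: "pencil D R x y *v v = l *s v" and w: "pencil D R x y *v w = l *s w"
    and "v \<noteq> 0" and "\<nexists>c. w = c *s v"
  \<comment> \<open>The curve is det(tI + xD + yR) = 0, so the eigenvalue \<open>l\<close>
    corresponds to t = -l.\<close>
  define A where "A = mat (- l) + pencil D R x y"
  have "A *v v = 0" "A *v w = 0"
    using v w by (simp_all add: A_def matrix_vector_mult_add_rdistrib)
  then have "det A = 0" "\<And>N. det_deriv A N = 0"
    using det_eq_0_if_kernel det_deriv_eq_0_if_kernel \<open>v \<noteq> 0\<close> \<open>\<nexists>c. w = c *s v\<close> by blast+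
  then have "eval3 (Phi (D, R)) (- l) x y = 0" "eval3 (pderiv_t (Phi (D, R))) (- l) x y = 0"
    "eval3 (pderiv_x (Phi (D, R))) (- l) x y = 0" "eval3 (pderiv_y (Phi (D, R))) (- l) x y = 0"
    by (simp_all add: eval3_Phi eval3_pderiv_Phi A_def)
  moreover have "(- l, x, y) \<noteq> (0, 0, 0)" using xy by auto
  ultimately show False using assms(1) unfolding smooth_curve_def by blast
qed

lemma dPhi_injective:
  assumes v: "(D, R) \<in> M_space" and w: "(D', R') \<in> M_space"
    and smooth: "smooth_curve (Phi (D, R))" and zero: "dPhi (D, R) (D', R') = 0"
  shows "D' = 0" "R' = 0"
proof -
  have diag: "D $ i $ j = 0" "D' $ i $ j = 0" if "i \<noteq> j" for i j
    using v w that by (auto simp: M_space_def)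
  have sym: "transpose R = R" "transpose R' = R'" using v w by (auto simp: M_space_def)
  have symD: "transpose A = A" if "\<And>i j. i \<noteq> j \<Longrightarrow> A $ i $ j = 0" for A :: "complex^'a^'a"
    using that by (simp add: vec_eq_iff transpose_def) metis
  have nd: "nonderogatory (pencil D R x y)" if "(x, y) \<noteq> (0, 0)" for x y
    using smooth_imp_nonderogatory[OF smooth that] .
  have ex: "\<exists>Y. transpose Y = - Y \<and> commutator (pencil D R x y) Y = pencil D' R' x y"
    if xy: "(x, y) \<noteq> (0, 0)" for x y
    unfolding commutator_def
  proof (rule ex_antisymmetric_commutator[OF nd[OF xy]])
    show "transpose (pencil D R x y) = pencil D R x y"
      "transpose (pencil D' R' x y) = pencil D' R' x y"
      using diag sym symD by (simp_all add: transpose_pencil)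
    fix q
    show "trace (poly_mat (pencil D R x y) q ** pencil D' R' x y) = 0"
    proof (rule trace_poly_mat_eq_0)
      fix s :: complex assume "s \<noteq> 0"
      \<comment> \<open>The vanishing polynomial is evaluated at (1, sx, sy), which turns T(x,y) and
        N(x,y) into their multiples by \<open>s\<close>.\<close>
      have "det_deriv (mat 1 + mat s ** pencil D R x y) (mat s ** pencil D' R' x y) = 0"
        using eval3_dPhi[of D R D' R' 1 "s * x" "s * y"] by (simp add: zero eval3_0 pencil_scale)
      then show "det_deriv (mat 1 + mat s ** pencil D R x y) (pencil D' R' x y) = 0"
        using \<open>s \<noteq> 0\<close> by (simp add: det_deriv_mat_mult)
    qed
  qed
  show "D' = 0" "R' = 0" using pencil_rigidity[OF diag sym(1) nd ex] by blast+
qed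

section \<open>The differential of Phi\<close>

lemma has_differential_sum:
  assumes "\<And>a. a \<in> A \<Longrightarrow> has_differential (f a) (L a) v M"
  shows "has_differential (\<lambda>w. \<Sum>a\<in>A. f a w) (\<lambda>w. \<Sum>a\<in>A. L a w) v M"
  using assms unfolding has_differential_def coeff3_sum by (auto intro: has_derivative_sum)

lemma has_differential_const: "has_differential (\<lambda>_. c) (\<lambda>_. 0) v M"
  by (simp add: has_differential_def coeff3_0)

text \<open>Each coefficient of a product is a finite convolution of coefficients, so the scalar
  product rule applies termwise.\<close>

lemma has_differential_mult:
  assumes "has_differential f L v M" "has_differential g K v M"
  shows "has_differential (\<lambda>w. f w * g w) (\<lambda>w. f v * K w + L w * g v) v M"
  using assms unfolding has_differential_def coeff3_mult coeff3_add sum.distrib[symmetric]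
  by (intro allI has_derivative_sum has_derivative_mult) auto

lemma has_differential_prod:
  assumes "finite A" "\<And>a. a \<in> A \<Longrightarrow> has_differential (f a) (L a) v M"
  shows "has_differential (\<lambda>w. \<Prod>a\<in>A. f a w) (\<lambda>w. \<Sum>a\<in>A. L a w * (\<Prod>k\<in>A - {a}. f k v)) v M"
  using assms
proof (induction A rule: finite_induct)
  case empty
  show ?case by (simp add: has_differential_const)
next
  case (insert a A)
  have "(\<Prod>k\<in>insert a A - {i}. f k v) = f a v * (\<Prod>k\<in>A - {i}. f k v)" if "i \<in> A" for i
    using that insert.hyps by (subst insert_Diff_if) auto
  then have "(\<Sum>i\<in>A. L i w * (\<Prod>k\<in>insert a A - {i}. f k v)) =
      f a v * (\<Sum>i\<in>A. L i w * (\<Prod>k\<in>A - {i}. f k v))" for w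
    unfolding sum_distrib_left by (intro sum.cong) (simp_all add: mult_ac)
  moreover have "insert a A - {a} = A" using insert.hyps by auto
  moreover have "has_differential (\<lambda>w. f a w * (\<Prod>a\<in>A. f a w))
     (\<lambda>w. f a v * (\<Sum>i\<in>A. L i w * (\<Prod>k\<in>A - {i}. f k v)) + L a w * (\<Prod>a\<in>A. f a v)) v M"
    using insert by (intro has_differential_mult) auto
  ultimately show ?case using insert.hyps by (simp add: add.commute)
qed

lemma has_differential_det:
  assumes "\<And>i j. has_differential (\<lambda>w. P w $ i $ j) (\<lambda>w. N w $ i $ j) v M"
  shows "has_differential (\<lambda>w. det (P w)) (\<lambda>w. det_deriv (P v) (N w)) v M"
  unfolding det_def det_deriv_Leibniz
proof (rule has_differential_sum)
  fix p
  have "has_differential (\<lambda>w. of_int (sign p) * (\<Prod>i\<in>UNIV. P w $ i $ p i))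
     (\<lambda>w. of_int (sign p) * (\<Sum>i\<in>UNIV. N w $ i $ p i * (\<Prod>k\<in>UNIV - {i}. P v $ k $ p k))
        + 0 * (\<Prod>i\<in>UNIV. P v $ i $ p i)) v M"
    by (intro has_differential_mult has_differential_const has_differential_prod assms) simp
  then show "has_differential (\<lambda>w. of_int (sign p) * (\<Prod>i\<in>UNIV. P w $ i $ p i))
     (\<lambda>w. of_int (sign p) * (\<Sum>i\<in>UNIV. N w $ i $ p i * (\<Prod>k\<in>UNIV - {i}. P v $ k $ p k))) v M"
    by simp
qed

lemma has_differential_Phi:
  fixes v :: "(complex^'n^'n) \<times> (complex^'n^'n)"
  shows "has_differential Phi (dPhi v) v M"
proof -
  have "has_differential (\<lambda>w. Phi_mat w $ i $ j) (\<lambda>w. Phi_dir w $ i $ j) v M" for i j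
    unfolding has_differential_def
  proof (intro allI)
    fix a b c
    have 1: "coeff3 (Phi_mat w $ i $ j) a b c = coeff3 (mat var_t $ i $ j) a b c +
        coeff3 (Phi_dir w $ i $ j) a b c" for w :: "(complex^'n^'n) \<times> (complex^'n^'n)"
      by (cases w) (simp add: Phi_mat_def Phi_dir_def coeff3_add)
    have 2: "coeff3 (Phi_dir w $ i $ j) a b c = (if (a, b, c) = (0, 1, 0) then fst w $ i $ j
        else if (a, b, c) = (0, 0, 1) then snd w $ i $ j else 0)"
      for w :: "(complex^'n^'n) \<times> (complex^'n^'n)"
      by (cases w) (auto simp: Phi_dir_def coeff3_add coeff3_var_mult_const3)
    have "bounded_linear (\<lambda>w :: (complex^'n^'n) \<times> (complex^'n^'n). coeff3 (Phi_dir w $ i $ j) a b c)"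
    proof -
      have "bounded_linear (\<lambda>w :: (complex^'n^'n) \<times> (complex^'n^'n). fst w $ i $ j)"
        "bounded_linear (\<lambda>w :: (complex^'n^'n) \<times> (complex^'n^'n). snd w $ i $ j)"
        by (intro bounded_linear_compose[OF bounded_linear_vec_nth]
            bounded_linear_fst bounded_linear_snd)+
      then have "bounded_linear (\<lambda>w :: (complex^'n^'n) \<times> (complex^'n^'n).
          if P then fst w $ i $ j else if Q then snd w $ i $ j else 0)" for P Q
        by (cases P; cases Q) (simp_all add: bounded_linear_zero)
      then show ?thesis unfolding 2 .
    qed
    then show "((\<lambda>w. coeff3 (Phi_mat w $ i $ j) a b c) has_derivative
        (\<lambda>w. coeff3 (Phi_dir w $ i $ j) a b c)) (at v within M)"
      unfolding 1
      using has_derivative_add[OF has_derivative_const bounded_linear_imp_has_derivative] by simp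
  qed
  from has_differential_det[OF this] show ?thesis
    by (simp add: dPhi_def[abs_def] Phi_conv_det[abs_def])
qed


section \<open>The tangent space of the affine space of polynomials\<close>

lemma coeff3_homogeneous_eq_0: "homogeneous3 d p \<Longrightarrow> i + j + k \<noteq> d \<Longrightarrow> coeff3 p i j k = 0"
  by (auto simp: homogeneous3_def)

text \<open>Only the monomial t^d survives at (1,0,0), so the normalization in
  \<open>F_space\<close> fixes one coefficient.\<close>

lemma eval3_homogeneous_1_0_0:
  assumes "homogeneous3 d p"
  shows "eval3 p 1 0 0 = coeff3 p d 0 0"
proof -
  have "poly p 1 = (\<Sum>i\<le>degree p. coeff p i)" by (simp add: poly_altdef)
  then have "eval3 p 1 0 0 = (\<Sum>i\<le>degree p. coeff3 p i 0 0)"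
    by (simp add: eval3_def poly_0_coeff_0 coeff_sum coeff3_def flip: one_pCons)
  also have "\<dots> = (\<Sum>i\<le>degree p. if i = d then coeff3 p d 0 0 else 0)"
    using coeff3_homogeneous_eq_0[OF assms] by (intro sum.cong) auto
  also have "\<dots> = coeff3 p d 0 0"
    by (auto simp: coeff3_def coeff_eq_0)
  finally show ?thesis .
qed

lemma F_space_translations:
  assumes "f \<in> F_space d"
  shows "{p - q | p q. p \<in> F_space d \<and> q \<in> F_space d} = {g. homogeneous3 d g \<and> coeff3 g d 0 0 = 0}"
proof (intro equalityI subsetI)
  fix g assume "g \<in> {p - q | p q. p \<in> F_space d \<and> q \<in> F_space d}"
  then obtain p q where g: "g = p - q" and pq: "p \<in> F_space d" "q \<in> F_space d" by blast
  then have "homogeneous3 d g" by (simp add: F_space_def homogeneous3_diff)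
  moreover have "eval3 g 1 0 0 = 0" using g pq by (simp add: F_space_def eval3_diff)
  ultimately show "g \<in> {g. homogeneous3 d g \<and> coeff3 g d 0 0 = 0}"
    by (simp add: eval3_homogeneous_1_0_0)
next
  fix g assume g: "g \<in> {g. homogeneous3 d g \<and> coeff3 g d 0 0 = 0}"
  then have "eval3 g 1 0 0 = 0" using eval3_homogeneous_1_0_0[of d g] by simp
  then have "f + g \<in> F_space d"
    using assms g by (simp add: F_space_def homogeneous3_add eval3_add)
  moreover have "g = (f + g) - f" by simp
  ultimately show "g \<in> {p - q | p q. p \<in> F_space d \<and> q \<in> F_space d}" using assms by blast
qed

lemma homogeneous3_dPhi: "homogeneous3 CARD('n) (dPhi v w)"
  for v w :: "(complex^'n^'n) \<times> (complex^'n^'n)"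
proof -
  have "homogeneous3 1 (var_x * const3 c)" "homogeneous3 1 (var_y * const3 c)" "homogeneous3 1 var_t" for c
    by (auto simp: homogeneous3_def coeff3_var_mult_const3 coeff3_var_t split: if_splits)
  then show ?thesis
    unfolding dPhi_def
    by (cases v, cases w, intro homogeneous3_det_deriv)
       (simp_all add: Phi_mat_def Phi_dir_def mat_nth homogeneous3_add homogeneous3_0)
qed

lemma coeff3_dPhi_0: "coeff3 (dPhi v w) CARD('n) 0 0 = 0"
  for v w :: "(complex^'n^'n) \<times> (complex^'n^'n)"
proof -
  obtain D R D' R' where vw: "v = (D, R)" "w = (D', R')" by (metis surj_pair)
  \<comment> \<open>Zero is written as a scalar multiple so that \<open>det_deriv_mat_mult\<close>
    applies.\<close>
  have "pencil D' R' 0 0 = mat 0 ** mat 1" by (simp add: pencil_def vec_eq_iff)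
  then have "eval3 (dPhi v w) 1 0 0 = 0"
    unfolding vw eval3_dPhi by (simp only: det_deriv_mat_mult mult_zero_left)
  then show ?thesis using eval3_homogeneous_1_0_0[OF homogeneous3_dPhi, of v w] by simp
qed

section \<open>Coordinates on both sides and the dimension count\<close>

text \<open>Exponents of x and y only, since d determines that of t. Leaving out (0,0) removes t^d,
  so these coefficients are coordinates on the tangent space.\<close>

definition monomials :: "nat \<Rightarrow> (nat \<times> nat) set" where
  "monomials d = {(j, k). 1 \<le> j + k \<and> j + k \<le> d}"

lemma translation_eqI:
  assumes "homogeneous3 d p" "homogeneous3 d q" "coeff3 p d 0 0 = 0" "coeff3 q d 0 0 = 0"
    and "\<And>j k. (j, k) \<in> monomials d \<Longrightarrow> coeff3 p (d - j - k) j k = coeff3 q (d - j - k) j k"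
  shows "p = q"
proof (rule coeff3_eqI)
  fix i j k
  show "coeff3 p i j k = coeff3 q i j k"
  proof (cases "i + j + k = d")
    case False
    then show ?thesis using assms(1,2) by (simp add: coeff3_homogeneous_eq_0)
  next
    case True
    then have "i = d - j - k" by simp
    then show ?thesis using True assms(3-5) by (cases "j + k = 0") (auto simp: monomials_def)
  qed
qed

lemma finite_monomials: "finite (monomials d)"
  by (rule finite_subset[of _ "{..d} \<times> {..d}"]) (auto simp: monomials_def)

text \<open>Passing from \<open>d\<close> to \<open>Suc d\<close> adds the antidiagonal j + k = d +
  1, which has d + 2 points.\<close>

lemma card_monomials: "2 * card (monomials d) = d * (d + 3)"
proof (induction d)
  case 0
  have "monomials 0 = {}" by (auto simp: monomials_def)
  then show ?case by simp
next
  case (Suc d)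
  have "monomials (Suc d) = monomials d \<union> (\<lambda>j. (j, Suc d - j)) ` {..Suc d}"
    by (auto simp: monomials_def image_iff)
  moreover have "monomials d \<inter> (\<lambda>j. (j, Suc d - j)) ` {..Suc d} = {}"
    by (auto simp: monomials_def)
  moreover have "card ((\<lambda>j. (j, Suc d - j)) ` {..Suc d}) = d + 2"
    by (subst card_image) (auto simp: inj_on_def)
  ultimately have "card (monomials (Suc d)) = card (monomials d) + (d + 2)"
    by (simp add: card_Un_disjoint finite_monomials)
  then show ?case using Suc by (simp add: algebra_simps)
qed

text \<open>The entry of the symmetric matrix at \<open>(i, j)\<close> is indexed by the set \<open>{i, j}\<close>.\<close>

definition sym_indices :: "'n set set" where
  "sym_indices = {S. card S = 1 \<or> card S = 2}"

definition M_indices :: "('n + 'n set) set" where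
  "M_indices = Inl ` UNIV \<union> Inr ` sym_indices"

definition M_of_coords :: "('n + 'n set \<Rightarrow> complex) \<Rightarrow> (complex^'n^'n) \<times> (complex^'n^'n)" where
  "M_of_coords c = ((\<chi> i j. if i = j then c (Inl i) else 0), (\<chi> i j. c (Inr {i, j})))"

lemma M_of_coords_in_M_space: "M_of_coords c \<in> M_space"
  by (simp add: M_of_coords_def M_space_def transpose_def vec_eq_iff insert_commute)

lemma M_of_coords_eq_0:
  assumes "M_of_coords c = (0, 0)" and a: "a \<in> M_indices"
  shows "c a = 0"
proof -
  have D: "c (Inl i) = 0" and R: "c (Inr {i, j}) = 0" for i j
    using assms(1) by (auto simp: M_of_coords_def vec_eq_iff split: if_splits)
  show ?thesis
    using a R[of x x for x] D R
    by (auto simp: M_indices_def sym_indices_def card_1_singleton_iff card_2_iff)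
qed

lemma card_M_indices: "2 * card (M_indices :: ('n::finite + 'n set) set) = CARD('n) * (CARD('n) + 3)"
proof -
  have "card {S :: 'n set. card S = k} = CARD('n) choose k" for k
    using n_subsets[of "UNIV :: 'n set" k] by simp
  moreover have "card (sym_indices :: 'n set set) =
      card {S :: 'n set. card S = 1} + card {S :: 'n set. card S = 2}"
    unfolding sym_indices_def Collect_disj_eq by (rule card_Un_disjoint) auto
  ultimately have "card (sym_indices :: 'n set set) = CARD('n) + (CARD('n) choose 2)"
    by simp
  moreover have "card (M_indices :: ('n + 'n set) set) = CARD('n) + card (sym_indices :: 'n set set)"
    unfolding M_indices_def
    by (subst card_Un_disjoint) (auto simp: card_image)
  moreover have "2 * (n choose 2) = n * (n - 1)" for n :: nat
    by (cases n) (simp_all add: choose_two)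
  moreover have "(0::nat) < CARD('n)" by simp
  ultimately show ?thesis by (cases "CARD('n)") (simp_all add: algebra_simps)
qed

text \<open>Cofactor expansion is linear in the entries of the direction; this yields the rows of
  the matrix of the differential in coordinates.\<close>

lemma coeff3_dPhi_linear:
  fixes v :: "(complex^'n^'n) \<times> (complex^'n^'n)"
  shows "\<exists>A. \<forall>c. coeff3 (dPhi v (M_of_coords c)) i j k = (\<Sum>a\<in>M_indices. c a * A a)"
proof -
  define \<alpha> where "\<alpha> p q = coeff3 (var_x * cofactor (Phi_mat v) p q) i j k" for p q
  define \<beta> where "\<beta> p q = coeff3 (var_y * cofactor (Phi_mat v) p q) i j k" for p q
  define A where "A a = (case a of Inl p \<Rightarrow> \<alpha> p p
      | Inr S \<Rightarrow> \<Sum>(p, q) | {p, q} = S. \<beta> p q)" for a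
  have "coeff3 (dPhi v (M_of_coords c)) i j k = (\<Sum>a\<in>M_indices. c a * A a)" for c
  proof -
    have cof: "coeff3 ((var_x * const3 a + var_y * const3 b) * cofactor (Phi_mat v) p q) i j k
        = a * \<alpha> p q + b * \<beta> p q" for a b p q
    proof -
      have "(var_x * const3 a + var_y * const3 b) * cofactor (Phi_mat v) p q =
          const3 a * (var_x * cofactor (Phi_mat v) p q) + const3 b * (var_y * cofactor (Phi_mat v) p q)"
        by (simp add: algebra_simps)
      then show ?thesis by (simp only: coeff3_add coeff3_const3_mult \<alpha>_def \<beta>_def)
    qed
    have "coeff3 (dPhi v (M_of_coords c)) i j k =
        (\<Sum>p\<in>UNIV. \<Sum>q\<in>UNIV. (if p = q then c (Inl p) else 0) * \<alpha> p q + c (Inr {p, q}) * \<beta> p q)"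
      by (simp add: dPhi_def det_deriv_cofactor coeff3_sum Phi_dir_def M_of_coords_def cof)
    also have "\<dots> = (\<Sum>p\<in>UNIV. c (Inl p) * \<alpha> p p) + (\<Sum>p\<in>UNIV. \<Sum>q\<in>UNIV. c (Inr {p, q}) * \<beta> p q)"
    proof -
      have "(\<Sum>q\<in>UNIV. (if p = q then c (Inl p) else 0) * \<alpha> p q) = c (Inl p) * \<alpha> p p" for p
        by (subst sum.mono_neutral_right[of _ "{p}"]) auto
      then show ?thesis by (simp only: sum.distrib)
    qed
    also have "(\<Sum>p\<in>UNIV. \<Sum>q\<in>UNIV. c (Inr {p, q}) * \<beta> p q) =
        (\<Sum>u\<in>UNIV. c (Inr {fst u, snd u}) * \<beta> (fst u) (snd u))"
      by (simp add: sum.cartesian_product case_prod_unfold)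
    \<comment> \<open>Ordered positions are grouped by their unordered pair, since an off-diagonal
      coordinate of \<open>R\<close> occupies two positions.\<close>
    also have "\<dots> = (\<Sum>S\<in>sym_indices. \<Sum>u | u \<in> UNIV \<and> {fst u, snd u} = S.
        c (Inr {fst u, snd u}) * \<beta> (fst u) (snd u))"
      by (rule sum.group[symmetric]) (auto simp: sym_indices_def card_insert_if split: if_splits)
    also have "\<dots> = (\<Sum>S\<in>sym_indices. c (Inr S) * A (Inr S))"
      by (intro sum.cong refl) (auto simp: A_def sum_distrib_left case_prod_unfold intro!: sum.cong)
    finally show ?thesis
      unfolding M_indices_def by (subst sum.union_disjoint) (auto simp: sum.reindex A_def)
  qed
  then show ?thesis by blast
qed

theorem corollary1p5:
  fixes D R :: "complex^'n^'n"
  assumes "(D, R) \<in> M_space"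
    and "Phi (D, R) \<in> H_smooth CARD('n)"
  shows "smooth_morphism_at Phi M_space (F_space CARD('n)) (D, R)"
proof -
  let ?d = "CARD('n)"
  have Phi: "Phi (D, R) \<in> F_space ?d" and smooth: "smooth_curve (Phi (D, R))"
    using assms(2) by (auto simp: H_smooth_def F_real_def)
  define V where "V = {g. homogeneous3 ?d g \<and> coeff3 g ?d 0 0 = 0}"
  have dPhi_V: "dPhi (D, R) w \<in> V" for w
    by (simp add: V_def homogeneous3_dPhi coeff3_dPhi_0)
  have V_eqI: "p = q" if "p \<in> V" "q \<in> V"
    "\<forall>(j, k)\<in>monomials ?d. coeff3 p (?d - j - k) j k = coeff3 q (?d - j - k) j k" for p q
    using that by (intro translation_eqI[of ?d]) (auto simp: V_def)
  \<comment> \<open>In coordinates the differential becomes a matrix \<open>A\<close>, square by the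
    two counts, so its trivial kernel will give surjectivity onto \<open>V\<close>.\<close>
  have "\<forall>b. \<exists>A. \<forall>c. coeff3 (dPhi (D, R) (M_of_coords c)) (?d - fst b - snd b) (fst b) (snd b) =
      (\<Sum>a\<in>M_indices. c a * A a)"
    using coeff3_dPhi_linear by blast
  from choice[OF this] obtain A where
    A: "\<And>b c. coeff3 (dPhi (D, R) (M_of_coords c)) (?d - fst b - snd b) (fst b) (snd b) =
      (\<Sum>a\<in>M_indices. c a * A b a)"
    by blast
  have card: "card (M_indices :: ('n + 'n set) set) = card (monomials ?d)"
    using card_M_indices[where 'n = 'n] card_monomials[of ?d] by simp
  have inj: "\<forall>a\<in>M_indices. c a = 0" if "\<forall>b\<in>monomials ?d. (\<Sum>a\<in>M_indices. c a * A b a) = 0" for c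
  proof -
    have "dPhi (D, R) (M_of_coords c) = 0"
      using that by (intro V_eqI dPhi_V)
        (auto simp: V_def homogeneous3_0 coeff3_0 A[symmetric] case_prod_unfold)
    then have "M_of_coords c = (0, 0)"
      using dPhi_injective[OF assms(1) _ smooth] M_of_coords_in_M_space[of c] by (metis surj_pair)
    then show ?thesis using M_of_coords_eq_0 by blast
  qed
  have "g \<in> dPhi (D, R) ` M_space" if g: "g \<in> V" for g
  proof -
    obtain c where c: "\<forall>b\<in>monomials ?d. (\<Sum>a\<in>M_indices. c a * A b a) =
        coeff3 g (?d - fst b - snd b) (fst b) (snd b)"
      using injective_square_system_solvable[OF _ finite_monomials card inj] by fastforce
    then have "dPhi (D, R) (M_of_coords c) = g"
      using g by (intro V_eqI dPhi_V) (auto simp: A[symmetric] case_prod_unfold)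
    then show ?thesis using M_of_coords_in_M_space by blast
  qed
  then have "dPhi (D, R) ` M_space = V" using dPhi_V by blast
  then show ?thesis
    unfolding smooth_morphism_at_def F_space_translations[OF Phi] V_def
    using has_differential_Phi by blast
qed

end
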